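(* There exists a universal constant $c>0$ such that for every $p\in[2,\infty)$ and all $d,n\in\mathbb N$ there exists an $\ell_p$ SCO problem $\mathcal P=(\Theta,\mathcal Z,f)\in\mathcal L_p^d$ such that for all $\varepsilon\in(0,1]$ and $\delta\in[0,1)$ with $\delta\le c/n$, every $(\varepsilon,\delta)$-differentially private algorithm $\mathcal A_n:\mathcal Z^n\to\mathcal M_1(\Theta)$ that is an $\alpha$-learner for $\mathcal P$ satisfies $$\alpha\ge c\cdot\min\left\{\left(\frac{d}{\varepsilon^2n^2}\right)^{1/p},\ \frac{d^{1-1/p}}{\varepsilon n},\ 1\right\}.$$
   Context: $\mathcal M_1(\mathcal R)$ denotes the set of probability measures on a measurable space $\mathcal R$, and $\mathcal B_p(r)=\{\theta\in\mathbb R^d:\|\theta\|_p\le r\}$. An SCO problem in dimension $d$ is a triple $\mathcal P=(\Theta,\mathcal Z,f)$ with $\mathcal Z$ a measurable data space, $\Theta\subset\mathbb R^d$ convex, and $f:\Theta\times\mathcal Z\to\mathbb R$ with $f(\cdot,z)$ convex for every $z\in\mathcal Z$. For $\mathcal D\in\mathcal M_1(\mathcal Z)$, let $F_{\mathcal D}(\theta)=\mathbb E_{Z\sim\mathcal D}[f(\theta,Z)]$. A (randomized) learning algorithm is a map $\mathcal A_n:\mathcal Z^n\to\mathcal M_1(\Theta)$; for $\alpha>0$ it is an $\alpha$-learner for $\mathcal P$ if for every $\mathcal D\in\mathcal M_1(\mathcal Z)$, $\mathbb E_{S_n\sim\mathcal D^{\otimes n},\hat\theta\sim\mathcal A_n(S_n)}[F_{\mathcal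 D}(\hat\theta)]-\inf_{\theta\in\Theta}F_{\mathcal D}(\theta)\le\alpha$. $\mathcal L_p^d$ ($\ell_p$ SCO problems) is the set of SCO problems $(\Theta,\mathcal Z,f)$ in dimension $d$ with $\Theta\subset\mathcal B_p(1)$ and $|f(\theta_1,z)-f(\theta_2,z)|\le\|\theta_1-\theta_2\|_p$ for all $\theta_1,\theta_2\in\Theta$, $z\in\mathcal Z$. For $\varepsilon>0$, $\delta\in[0,1)$, $\mathcal A_n$ is $(\varepsilon,\delta)$-differentially private (DP) if for any two datasets $S_n,S_n'\in\mathcal Z^n$ differing in one element and every measurable $M\subseteq\Theta$, $\Pr_{\hat\theta\sim\mathcal A_n(S_n)}(\hat\theta\in M)\le e^{\varepsilon}\Pr_{\hat\theta\sim\mathcal A_n(S_n')}(\hat\theta\in M)+\delta$. *)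

theory Defs
  imports "HOL-Probability.Probability"
begin

text \<open>
  The dimension \<open>d\<close> is quantified inside the constant of the theorem, so it cannot be a type:
  \<open>\<real>\<^sup>d\<close> is the set of extensional functions \<open>{..<d} \<rightarrow>\<^sub>E UNIV\<close>, with the product
  Borel \<open>\<sigma>\<close>-algebra. A measurable space \<open>R\<close> is represented by a measure of which only
  \<open>space R\<close> and \<open>sets R\<close> matter, and \<open>\<M>\<^sub>1(R)\<close> is \<open>space (prob_algebra R)\<close>.
\<close>

abbreviation Rd :: "nat \<Rightarrow> (nat \<Rightarrow> real) measure" where
  "Rd d \<equiv> PiM {..<d} (\<lambda>_. borel)"

definition lp_norm :: "real \<Rightarrow> nat \<Rightarrow> (nat \<Rightarrow> real) \<Rightarrow> real" where
  "lp_norm p d x = (\<Sum>i<d. \<bar>x i\<bar> powr p) powr (1 / p)"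

definition convex_comb :: "nat \<Rightarrow> real \<Rightarrow> (nat \<Rightarrow> real) \<Rightarrow> (nat \<Rightarrow> real) \<Rightarrow> nat \<Rightarrow> real" where
  "convex_comb d t x y = (\<lambda>i\<in>{..<d}. (1 - t) * x i + t * y i)"

definition lp_ball :: "real \<Rightarrow> nat \<Rightarrow> real \<Rightarrow> (nat \<Rightarrow> real) set" where
  "lp_ball p d r = {x \<in> space (Rd d). lp_norm p d x \<le> r}"

text \<open>
  \<open>\<Theta> \<noteq> {}\<close> is needed for the infimum of the risk over \<open>\<Theta>\<close> to make sense. The integrability
  clause (which contains measurability of \<open>f \<theta>\<close>) says that the risk is defined for
  every data distribution; without it the Bochner integral would default to \<open>0\<close>.
\<close>

definition sco_problem ::
  "nat \<Rightarrow> (nat \<Rightarrow> real) set \<Rightarrow> 'z measure \<Rightarrow> ((nat \<Rightarrow> real) \<Rightarrow> 'z \<Rightarrow> real) \<Rightarrow> bool" where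
  "sco_problem d \<Theta> Z f \<longleftrightarrow>
     \<Theta> \<subseteq> space (Rd d) \<and> \<Theta> \<noteq> {} \<and>
     (\<forall>x\<in>\<Theta>. \<forall>y\<in>\<Theta>. \<forall>t\<in>{0..1}. convex_comb d t x y \<in> \<Theta>) \<and>
     (\<forall>z\<in>space Z. \<forall>x\<in>\<Theta>. \<forall>y\<in>\<Theta>. \<forall>t\<in>{0..1}.
        f (convex_comb d t x y) z \<le> (1 - t) * f x z + t * f y z) \<and>
     (\<forall>D\<in>space (prob_algebra Z). \<forall>\<theta>\<in>\<Theta>. integrable D (f \<theta>))"

definition lp_sco_problem ::
  "real \<Rightarrow> nat \<Rightarrow> (nat \<Rightarrow> real) set \<Rightarrow> 'z measure \<Rightarrow> ((nat \<Rightarrow> real) \<Rightarrow> 'z \<Rightarrow> real) \<Rightarrow> bool" where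
  "lp_sco_problem p d \<Theta> Z f \<longleftrightarrow>
     sco_problem d \<Theta> Z f \<and> \<Theta> \<subseteq> lp_ball p d 1 \<and>
     (\<forall>x\<in>\<Theta>. \<forall>y\<in>\<Theta>. \<forall>z\<in>space Z. \<bar>f x z - f y z\<bar> \<le> lp_norm p d (\<lambda>i. x i - y i))"

definition risk :: "('t \<Rightarrow> 'z \<Rightarrow> real) \<Rightarrow> 'z measure \<Rightarrow> 't \<Rightarrow> real" where
  "risk f D \<theta> = (\<integral>z. f \<theta> z \<partial>D)"

abbreviation datasets :: "nat \<Rightarrow> 'z measure \<Rightarrow> (nat \<Rightarrow> 'z) measure" where
  "datasets n Z \<equiv> PiM {..<n} (\<lambda>_. Z)"

abbreviation param_space :: "nat \<Rightarrow> (nat \<Rightarrow> real) set \<Rightarrow> (nat \<Rightarrow> real) measure" where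
  "param_space d \<Theta> \<equiv> restrict_space (Rd d) \<Theta>"

definition learning_algorithm ::
  "nat \<Rightarrow> nat \<Rightarrow> (nat \<Rightarrow> real) set \<Rightarrow> 'z measure \<Rightarrow>
     ((nat \<Rightarrow> 'z) \<Rightarrow> (nat \<Rightarrow> real) measure) \<Rightarrow> bool" where
  "learning_algorithm d n \<Theta> Z A \<longleftrightarrow>
     A \<in> space (datasets n Z) \<rightarrow> space (prob_algebra (param_space d \<Theta>))"

text \<open>
  A learning algorithm is an arbitrary map, not necessarily a Markov kernel; the integrability
  clause asks for what is needed for the expected risk to be defined, and is automatic
  for Markov kernels when \<open>f\<close> is an \<open>\<ell>\<^sub>p\<close> problem.
\<close>

definition is_learner ::
  "real \<Rightarrow> nat \<Rightarrow> (nat \<Rightarrow> real) set \<Rightarrow> 'z measure \<Rightarrow> ((nat \<Rightarrow> real) \<Rightarrow> 'z \<Rightarrow> real) \<Rightarrow>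
     ((nat \<Rightarrow> 'z) \<Rightarrow> (nat \<Rightarrow> real) measure) \<Rightarrow> bool" where
  "is_learner \<alpha> n \<Theta> Z f A \<longleftrightarrow>
     (\<forall>D\<in>space (prob_algebra Z).
        integrable (datasets n D) (\<lambda>S. \<integral>\<theta>. risk f D \<theta> \<partial>A S) \<and>
        (\<integral>S. (\<integral>\<theta>. risk f D \<theta> \<partial>A S) \<partial>datasets n D) - (INF \<theta>\<in>\<Theta>. risk f D \<theta>) \<le> \<alpha>)"

definition diff_private ::
  "real \<Rightarrow> real \<Rightarrow> nat \<Rightarrow> nat \<Rightarrow> (nat \<Rightarrow> real) set \<Rightarrow> 'z measure \<Rightarrow>
     ((nat \<Rightarrow> 'z) \<Rightarrow> (nat \<Rightarrow> real) measure) \<Rightarrow> bool" where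
  "diff_private \<epsilon> \<delta> d n \<Theta> Z A \<longleftrightarrow>
     (\<forall>S\<in>space (datasets n Z). \<forall>S'\<in>space (datasets n Z).
        card {i. i < n \<and> S i \<noteq> S' i} = 1 \<longrightarrow>
        (\<forall>M\<in>sets (param_space d \<Theta>).
           measure (A S) M \<le> exp \<epsilon> * measure (A S') M + \<delta>))"

end

theory Submission
  imports Defs
begin

text \<open>
  Put \<open>r = d powr (-1/p)\<close>, \<open>\<Theta> = [-r, r]^d\<close>, let the data be sign vectors \<open>z \<in> {-1, 0, 1}^d\<close> with
  \<open>N\<close> nonzero entries, and take the linear loss \<open>- N powr (1/p - 1) \<langle>\<theta>, z\<rangle>\<close>, which is \<open>1\<close>-Lipschitz by
  Hoelder's inequality. The hard distributions have independent coordinates: \<open>z\<^sub>j\<close> is nonzero with probability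
  \<open>\<rho>\<close> and then has mean \<open>\<mu>\<^sub>j\<close>, where \<open>\<mu>\<close> is uniform on \<open>[-1, 1]^d\<close>.

  An accurate learner has output correlated with \<open>\<mu>\<close>. Integrating by parts in \<open>\<mu>\<^sub>j\<close> (fingerprinting),
  this makes the output correlated with the centred data points
  \<open>z - \<mu> \<bar>z\<bar>\<close>, by a total of order \<open>d\<close>. Privacy limits the correlation with each of the \<open>n\<close> points to order
  \<open>\<epsilon> min (sqrt (d \<rho>)) (d \<rho>) + \<delta> d \<rho>\<close>, so for \<open>\<rho>\<close> the larger of \<open>d / (\<epsilon> n)\<^sup>2\<close> and \<open>1 / (\<epsilon> n)\<close>, up to constants
  and capped at \<open>1\<close>, the learner must fail on a constant fraction of the attainable risk \<open>r d \<rho> (1 + d \<rho>) powr (1/p - 1)\<close>.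
\<close>

section \<open>Integrals under close probability measures\<close>

text \<open>A learning algorithm is an arbitrary map on datasets, so nothing is known about its
  measurability in the dataset. Over a finite discrete space every real function is integrable, and
  expectations over the data become finite weighted sums that can be rearranged freely.\<close>

lemma integral_finite_space:
  fixes g :: "'a \<Rightarrow> real"
  assumes "finite_measure M" "finite (space M)" "sets M = Pow (space M)"
  shows "integrable M g" and "(\<integral>x. g x \<partial>M) = (\<Sum>x\<in>space M. measure M {x} * g x)"
proof -
  interpret finite_measure M by fact
  have *: "g x = (\<Sum>y\<in>space M. g y * indicator {y} x)" if "x \<in> space M" for x
    using that assms(2) by (simp add: indicator_def if_distrib sum.delta cong: if_cong)
  have s: "{y} \<in> sets M" if "y \<in> space M" for y using that assms(3) by auto
  have i: "integrable M (\<lambda>x. g y * indicator {y} x)" if "y \<in> space M" for y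
    using s[OF that] by (intro integrable_mult_right integrable_real_indicator) (auto simp: emeasure_eq_measure)
  show "integrable M g"
    by (subst Bochner_Integration.integrable_cong[OF refl *]) (auto intro!: Bochner_Integration.integrable_sum i)
  have "(\<integral>x. g x \<partial>M) = (\<integral>x. (\<Sum>y\<in>space M. g y * indicator {y} x) \<partial>M)"
    by (intro Bochner_Integration.integral_cong refl *)
  also have "\<dots> = (\<Sum>y\<in>space M. \<integral>x. g y * indicator {y} x \<partial>M)"
    by (intro Bochner_Integration.integral_sum i)
  also have "\<dots> = (\<Sum>x\<in>space M. measure M {x} * g x)"
    using s by (intro sum.cong refl) (simp add: mult.commute)
  finally show "(\<integral>x. g x \<partial>M) = (\<Sum>x\<in>space M. measure M {x} * g x)" .
qed

lemma PiM_finite_discrete: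
  assumes "finite I" "finite A" "prob_space D" "space D = A" "sets D = Pow A"
  shows "prob_space (PiM I (\<lambda>_. D))" "space (PiM I (\<lambda>_. D)) = I \<rightarrow>\<^sub>E A"
    "sets (PiM I (\<lambda>_. D)) = Pow (I \<rightarrow>\<^sub>E A)"
    "\<And>S. S \<in> I \<rightarrow>\<^sub>E A \<Longrightarrow> measure (PiM I (\<lambda>_. D)) {S} = (\<Prod>i\<in>I. measure D {S i})"
proof -
  interpret D: prob_space D by fact
  interpret product_prob_space "\<lambda>_. D" I by standard
  interpret finite_product_prob_space "\<lambda>_. D" I by standard fact
  show "prob_space (PiM I (\<lambda>_. D))" by (rule prob_space_axioms)
  show "space (PiM I (\<lambda>_. D)) = I \<rightarrow>\<^sub>E A" using assms by (simp add: space_PiM)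
  have "sets (PiM I (\<lambda>_. D)) = sets (PiM I (\<lambda>_. count_space A))"
    using assms by (intro sets_PiM_cong) auto
  then show "sets (PiM I (\<lambda>_. D)) = Pow (I \<rightarrow>\<^sub>E A)"
    using assms by (simp add: count_space_PiM_finite countable_finite)
  fix S assume S: "S \<in> I \<rightarrow>\<^sub>E A"
  then have "{S} = (\<Pi>\<^sub>E i\<in>I. {S i})" by (simp add: PiE_singleton PiE_iff)
  moreover have "measure (PiM I (\<lambda>_. D)) (\<Pi>\<^sub>E i\<in>I. {S i}) = (\<Prod>i\<in>I. measure D {S i})"
    using S assms by (intro finite_measure_PiM_emb) (auto dest: PiE_mem)
  ultimately show "measure (PiM I (\<lambda>_. D)) {S} = (\<Prod>i\<in>I. measure D {S i})" by simp
qed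

text \<open>The sum \<open>c\<close> is the integer part of \<open>K * t\<close>: the index range up
  to \<open>K\<close> cuts nothing off because \<open>t \<le> 1\<close>.\<close>

lemma card_multiples_le:
  fixes t :: real and K :: nat
  assumes "0 \<le> t" "t \<le> 1"
  defines "c \<equiv> (\<Sum>i\<in>{1..K}. if real i \<le> K * t then 1 else 0 :: real)"
  shows "c \<le> K * t" "K * t \<le> c + 1"
proof -
  have "{i \<in> {1..K}. real i \<le> K * t} = {1..nat \<lfloor>K * t\<rfloor>}"
  proof -
    have "i \<le> K" if "real i \<le> K * t" for i
      using that mult_left_mono[OF assms(2), of "real K"] by simp
    then show ?thesis using assms(1) by (auto simp: le_nat_iff le_floor_iff)
  qed
  then have "c = real (nat \<lfloor>K * t\<rfloor>)"
    unfolding c_def by (simp add: sum.If_cases Int_def)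
  moreover have "0 \<le> K * t" using assms by simp
  ultimately show "c \<le> K * t" "K * t \<le> c + 1" by linarith+
qed

text \<open>The sets \<open>{\<phi> \<ge> i B / K}\<close>, \<open>1 \<le> i \<le> K\<close>, approximate \<open>\<phi>\<close> from below up to \<open>B / K\<close>.\<close>

lemma integral_le_of_measure_le:
  fixes \<phi> :: "'a \<Rightarrow> real"
  assumes P: "prob_space P" and Q: "prob_space Q" and PQ: "sets P = sets Q"
    and le: "\<And>E. E \<in> sets Q \<Longrightarrow> measure P E \<le> a * measure Q E + \<delta>"
    and \<phi>: "\<phi> \<in> borel_measurable Q" "\<And>x. x \<in> space Q \<Longrightarrow> 0 \<le> \<phi> x" "\<And>x. x \<in> space Q \<Longrightarrow> \<phi> x \<le> B"
    and "0 \<le> a"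
  shows "(\<integral>x. \<phi> x \<partial>P) \<le> a * (\<integral>x. \<phi> x \<partial>Q) + \<delta> * B"
proof -
  interpret P: prob_space P by fact
  interpret Q: prob_space Q by fact
  have sp: "space P = space Q" using PQ by (rule sets_eq_imp_space_eq)
  have \<phi>P: "\<phi> \<in> borel_measurable P" using \<phi>(1) PQ measurable_cong_sets by blast
  have intQ: "integrable Q \<phi>"
    using \<phi> by (intro Q.integrable_const_bound[where B = B] AE_I2) auto
  have intP: "integrable P \<phi>"
    using \<phi> \<phi>P sp by (intro P.integrable_const_bound[where B = B] AE_I2) auto
  have B0: "0 \<le> B" using Q.not_empty \<phi>(2,3) by fastforce
  show ?thesis
  \<comment> \<open>The layers below are obtained after dividing by \<open>B\<close>.\<close>
  proof (cases "B = 0")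
    case True
    then have "\<And>x. x \<in> space Q \<Longrightarrow> \<phi> x = 0" using \<phi> by force
    then have "(\<integral>x. \<phi> x \<partial>P) = 0" "(\<integral>x. \<phi> x \<partial>Q) = 0"
      using sp by (auto intro!: integral_eq_zero_AE AE_I2)
    then show ?thesis using True by simp
  next
    case False
    then have B: "B > 0" using B0 by simp
    have bound: "(\<integral>x. \<phi> x \<partial>P) \<le> (a * (\<integral>x. \<phi> x \<partial>Q) + \<delta> * B) + B * inverse (real (Suc k))" for k
    proof -
      define K where "K = Suc k"
      define E where "E i = {x \<in> space Q. real i \<le> K * (\<phi> x / B)}" for i :: nat
      define c where "c x = (\<Sum>i\<in>{1..K}. indicator (E i) x :: real)" for x
      have E: "E i \<in> sets Q" "E i \<in> sets P" for i
        unfolding E_def using \<phi>(1) PQ by auto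
      have c: "c x \<le> K * (\<phi> x / B)" "K * (\<phi> x / B) \<le> c x + 1" if "x \<in> space Q" for x
      proof -
        have "c x = (\<Sum>i\<in>{1..K}. if real i \<le> K * (\<phi> x / B) then 1 else 0)"
          unfolding c_def E_def using that by (intro sum.cong) (auto simp: indicator_def)
        then show "c x \<le> K * (\<phi> x / B)" "K * (\<phi> x / B) \<le> c x + 1"
          using card_multiples_le[of "\<phi> x / B" K] \<phi>(2,3)[OF that] B by auto
      qed
      have intc: "integrable P c" "integrable Q c"
        unfolding c_def using E
        by (auto intro!: Bochner_Integration.integrable_sum integrable_real_indicator
            simp: P.emeasure_eq_measure Q.emeasure_eq_measure)
      have ic: "(\<integral>x. c x \<partial>P) = (\<Sum>i\<in>{1..K}. measure P (E i))" "(\<integral>x. c x \<partial>Q) = (\<Sum>i\<in>{1..K}. measure Q (E i))"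
        unfolding c_def using E
        by (subst Bochner_Integration.integral_sum; auto intro!: integrable_real_indicator
            simp: P.emeasure_eq_measure Q.emeasure_eq_measure)+
      have "K / B * (\<integral>x. \<phi> x \<partial>P) = (\<integral>x. K * (\<phi> x / B) \<partial>P)" by simp
      also have "\<dots> \<le> (\<integral>x. c x + 1 \<partial>P)"
        using c sp intc intP by (intro integral_mono) auto
      also have "\<dots> = (\<Sum>i\<in>{1..K}. measure P (E i)) + 1"
        using intc by (simp add: ic P.prob_space)
      also have "\<dots> \<le> (\<Sum>i\<in>{1..K}. a * measure Q (E i) + \<delta>) + 1"
        using le E by (intro add_right_mono sum_mono) auto
      also have "\<dots> = a * (\<integral>x. c x \<partial>Q) + K * \<delta> + 1"
        by (simp add: sum.distrib sum_distrib_left ic)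
      also have "(\<integral>x. c x \<partial>Q) \<le> (\<integral>x. K * (\<phi> x / B) \<partial>Q)"
        using c intc intQ by (intro integral_mono) auto
      finally have "K / B * (\<integral>x. \<phi> x \<partial>P) \<le> a * (K / B * (\<integral>x. \<phi> x \<partial>Q)) + K * \<delta> + 1"
        using \<open>0 \<le> a\<close> by (simp add: mult_left_mono)
      moreover have "0 < K / B" using B by (simp add: K_def)
      moreover have "a * (K / B * (\<integral>x. \<phi> x \<partial>Q)) + K * \<delta> + 1
          = K / B * (a * (\<integral>x. \<phi> x \<partial>Q) + \<delta> * B + B * inverse (real K))"
        using B by (simp add: K_def distrib_left del: of_nat_Suc)
      ultimately show ?thesis
        unfolding K_def by (metis mult_le_cancel_left_pos)
    qed
    \<comment> \<open>The rounding error of \<open>K = Suc k\<close> layers is \<open>B / K\<close>;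
      letting \<open>k\<close> tend to infinity removes it.\<close>
    have "(\<lambda>k. (a * (\<integral>x. \<phi> x \<partial>Q) + \<delta> * B) + B * inverse (real (Suc k))) \<longlonglongrightarrow> (a * (\<integral>x. \<phi> x \<partial>Q) + \<delta> * B) + B * 0"
      by (intro tendsto_intros LIMSEQ_inverse_real_of_nat)
    from LIMSEQ_le_const[OF this] bound show ?thesis by auto
  qed
qed

text \<open>The positive and negative parts use the two closeness assumptions in opposite
  directions: the integral of the first under \<open>P\<close> is bounded above, that of the second
  is bounded below after multiplication by \<open>exp (- \<epsilon>)\<close>. For
  \<open>\<epsilon> \<le> 1\<close> both factors are within \<open>2 * \<epsilon>\<close> of 1. The
  error involves the absolute mean under \<open>Q\<close> only, which can later be averaged over a
  data point independent of \<open>Q\<close>.\<close>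

lemma integral_le_of_close:
  fixes \<phi> :: "'a \<Rightarrow> real"
  assumes P: "prob_space P" and Q: "prob_space Q" and PQ: "sets P = sets Q"
    and le: "\<And>E. E \<in> sets Q \<Longrightarrow> measure P E \<le> exp \<epsilon> * measure Q E + \<delta>"
            "\<And>E. E \<in> sets Q \<Longrightarrow> measure Q E \<le> exp \<epsilon> * measure P E + \<delta>"
    and \<phi>: "\<phi> \<in> borel_measurable Q" "\<And>x. x \<in> space Q \<Longrightarrow> \<bar>\<phi> x\<bar> \<le> B"
    and \<epsilon>: "0 \<le> \<epsilon>" "\<epsilon> \<le> 1" and "0 \<le> \<delta>"
  shows "(\<integral>x. \<phi> x \<partial>P) \<le> (\<integral>x. \<phi> x \<partial>Q) + 2 * \<epsilon> * (\<integral>x. \<bar>\<phi> x\<bar> \<partial>Q) + 2 * \<delta> * B"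
proof -
  interpret P: prob_space P by fact
  interpret Q: prob_space Q by fact
  define f where "f x = max 0 (\<phi> x)" for x
  define g where "g x = max 0 (- \<phi> x)" for x
  have sp: "space P = space Q" using PQ by (rule sets_eq_imp_space_eq)
  have m: "f \<in> borel_measurable Q" "g \<in> borel_measurable Q"
    unfolding f_def g_def using \<phi>(1) by measurable
  have mP: "f \<in> borel_measurable P" "g \<in> borel_measurable P"
    using m PQ measurable_cong_sets by blast+
  have B: "0 \<le> f x" "f x \<le> B" "0 \<le> g x" "g x \<le> B" if "x \<in> space Q" for x
    using \<phi>(2)[OF that] unfolding f_def g_def by (auto simp: max_def)
  have int: "integrable Q f" "integrable Q g"
    using m B by (auto intro!: Q.integrable_const_bound[where B = B] AE_I2)
  have intP: "integrable P f" "integrable P g"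
    using mP B sp by (auto intro!: P.integrable_const_bound[where B = B] AE_I2)
  have \<phi>fg: "\<phi> x = f x - g x" "\<bar>\<phi> x\<bar> = f x + g x" for x unfolding f_def g_def by auto
  have e: "exp \<epsilon> \<le> 1 + 2 * \<epsilon>"
    using exp_bound[OF \<epsilon>] mult_left_mono[OF \<epsilon>(2) \<epsilon>(1)] by (simp add: power2_eq_square)
  have e': "1 - \<epsilon> \<le> exp (- \<epsilon>)" using exp_ge_add_one_self[of "- \<epsilon>"] by simp
  have f0: "0 \<le> (\<integral>x. f x \<partial>Q)" "0 \<le> (\<integral>x. g x \<partial>Q)" using B by (auto intro!: integral_nonneg_AE AE_I2)
  have B0: "0 \<le> B" using Q.not_empty B by fastforce
  have 1: "(\<integral>x. f x \<partial>P) \<le> exp \<epsilon> * (\<integral>x. f x \<partial>Q) + \<delta> * B"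
    using B m by (intro integral_le_of_measure_le P Q PQ le) auto
  \<comment> \<open>The negative part enters with a minus sign, so a lower bound under
    \<open>P\<close> is required and the roles of \<open>P\<close> and \<open>Q\<close> are
    swapped.\<close>
  have "(\<integral>x. g x \<partial>Q) \<le> exp \<epsilon> * (\<integral>x. g x \<partial>P) + \<delta> * B"
    using B mP PQ sp by (intro integral_le_of_measure_le P Q PQ[symmetric] le) auto
  from mult_left_mono[OF this, of "exp (- \<epsilon>)"]
  have "exp (- \<epsilon>) * (\<integral>x. g x \<partial>Q) \<le> exp (- \<epsilon>) * exp \<epsilon> * (\<integral>x. g x \<partial>P) + exp (- \<epsilon>) * (\<delta> * B)"
    by (simp only: distrib_left mult.assoc exp_ge_zero)
  moreover have "exp (- \<epsilon>) * exp \<epsilon> = 1" by (simp flip: exp_add)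
  ultimately have "exp (- \<epsilon>) * (\<integral>x. g x \<partial>Q) - exp (- \<epsilon>) * (\<delta> * B) \<le> (\<integral>x. g x \<partial>P)"
    by simp
  moreover have "exp (- \<epsilon>) * (\<delta> * B) \<le> 1 * (\<delta> * B)"
    using \<epsilon> B0 \<open>0 \<le> \<delta>\<close> by (intro mult_right_mono) auto
  moreover have "(1 - \<epsilon>) * (\<integral>x. g x \<partial>Q) \<le> exp (- \<epsilon>) * (\<integral>x. g x \<partial>Q)"
    using e' f0 by (intro mult_right_mono)
  moreover have "exp \<epsilon> * (\<integral>x. f x \<partial>Q) \<le> (1 + 2 * \<epsilon>) * (\<integral>x. f x \<partial>Q)"
    using e f0 by (intro mult_right_mono)
  moreover have "0 \<le> \<epsilon> * (\<integral>x. g x \<partial>Q)" using \<epsilon> f0 by simp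
  ultimately have "(\<integral>x. f x \<partial>P) - (\<integral>x. g x \<partial>P) \<le> (\<integral>x. f x \<partial>Q) - (\<integral>x. g x \<partial>Q)
      + 2 * \<epsilon> * ((\<integral>x. f x \<partial>Q) + (\<integral>x. g x \<partial>Q)) + 2 * \<delta> * B"
    using 1 by (simp add: algebra_simps)
  then show ?thesis using int intP by (simp only: \<phi>fg(2)) (simp add: \<phi>fg(1))
qed

section \<open>Sparse sign vectors\<close>

definition ternary :: "nat \<Rightarrow> (nat \<Rightarrow> real) set" where
  "ternary d = {..<d} \<rightarrow>\<^sub>E {-1, 0, 1}"

text \<open>Law of one coordinate on {-1, 0, 1}: given a nonzero value, the sign has mean
  \<open>t\<close>. For each \<open>u\<close> it is affine in \<open>t\<close> on the whole real
  line, so it can be differentiated in the parameter.\<close>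

definition coord_wt :: "real \<Rightarrow> real \<Rightarrow> real \<Rightarrow> real" where
  "coord_wt \<rho> t u = (if u = 0 then 1 - \<rho> else \<rho> * (1 + t * u) / 2)"

definition data_wt :: "real \<Rightarrow> nat \<Rightarrow> (nat \<Rightarrow> real) \<Rightarrow> (nat \<Rightarrow> real) \<Rightarrow> real" where
  "data_wt \<rho> d \<mu> z = (\<Prod>j<d. coord_wt \<rho> (\<mu> j) (z j))"

text \<open>The subtracted term is the conditional mean given the absolute value. On sign vectors
  the result is \<open>1 - (\<mu> j)\<^sup>2\<close> times the score of coordinate \<open>j\<close>,
  and it vanishes wherever \<open>z j\<close> does.\<close>

definition centred :: "(nat \<Rightarrow> real) \<Rightarrow> (nat \<Rightarrow> real) \<Rightarrow> nat \<Rightarrow> real" where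
  "centred \<mu> z j = z j - \<mu> j * \<bar>z j\<bar>"

lemma finite_ternary [simp]: "finite (ternary d)"
  unfolding ternary_def by (intro finite_PiE) auto

lemma ternaryD: "z \<in> ternary d \<Longrightarrow> j < d \<Longrightarrow> z j = -1 \<or> z j = 0 \<or> z j = 1"
  unfolding ternary_def by (auto dest: PiE_mem)

lemma coord_wt_nonneg:
  assumes "0 \<le> \<rho>" "\<rho> \<le> 1" "\<bar>t\<bar> \<le> 1" "u = -1 \<or> u = 0 \<or> u = 1"
  shows "0 \<le> coord_wt \<rho> t u"
  using assms by (auto simp: coord_wt_def abs_le_iff)

lemma data_wt_nonneg:
  assumes "0 \<le> \<rho>" "\<rho> \<le> 1" "\<forall>j<d. \<bar>\<mu> j\<bar> \<le> 1" "z \<in> ternary d"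
  shows "0 \<le> data_wt \<rho> d \<mu> z"
  unfolding data_wt_def using assms by (intro prod_nonneg ballI coord_wt_nonneg) (auto dest: ternaryD)

text \<open>Independence of the coordinates. The moments below take \<open>g\<close> equal to 1 on
  all but one or two coordinates, where the one-dimensional weights add up to 1.\<close>

lemma sum_data_wt_prod:
  "(\<Sum>z\<in>ternary d. data_wt \<rho> d \<mu> z * (\<Prod>j<d. g j (z j)))
     = (\<Prod>j<d. \<Sum>u\<in>{-1, 0, 1}. coord_wt \<rho> (\<mu> j) u * g j u)"
  unfolding ternary_def data_wt_def by (subst prod_sum_PiE) (auto simp: prod.distrib)

lemma sum_data_wt: "(\<Sum>z\<in>ternary d. data_wt \<rho> d \<mu> z) = 1"
  using sum_data_wt_prod[of \<rho> d \<mu> "\<lambda>_ _. 1"] by (simp add: coord_wt_def field_simps)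

lemma sum_data_wt_coord:
  assumes "j < d"
  shows "(\<Sum>z\<in>ternary d. data_wt \<rho> d \<mu> z * g (z j)) = (\<Sum>u\<in>{-1, 0, 1}. coord_wt \<rho> (\<mu> j) u * g u)"
proof -
  have 1: "(\<Prod>k<d. if k = j then g (z k) else 1) = g (z j)" for z :: "nat \<Rightarrow> real"
    using assms by (simp add: prod.delta)
  have 2: "(\<Sum>u\<in>{-1, 0, 1}. coord_wt \<rho> (\<mu> k) u * (if k = j then g u else 1))
     = (if k = j then (\<Sum>u\<in>{-1, 0, 1}. coord_wt \<rho> (\<mu> k) u * g u) else 1)" for k
    by (simp add: coord_wt_def field_simps)
  show ?thesis
    using sum_data_wt_prod[of \<rho> d \<mu> "\<lambda>k u. if k = j then g u else 1"] assms
    unfolding 1 2 by (simp add: prod.delta)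
qed

lemma sum_data_wt_abs_pair:
  assumes "j < d" "k < d" "j \<noteq> k"
  shows "(\<Sum>z\<in>ternary d. data_wt \<rho> d \<mu> z * (\<bar>z j\<bar> * \<bar>z k\<bar>)) = \<rho>\<^sup>2"
proof -
  have 1: "(\<Prod>i<d. if i = j then \<bar>z i\<bar> else if i = k then \<bar>z i\<bar> else 1) = \<bar>z j\<bar> * \<bar>z k\<bar>"
    for z :: "nat \<Rightarrow> real"
  proof -
    have "(\<Prod>i<d. if i = j then \<bar>z i\<bar> else if i = k then \<bar>z i\<bar> else 1)
      = (\<Prod>i<d. (if i = j then \<bar>z i\<bar> else 1) * (if i = k then \<bar>z i\<bar> else 1))"
      using assms by (intro prod.cong) auto
    then show ?thesis using assms by (simp add: prod.distrib prod.delta)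
  qed
  have 2: "(\<Sum>u\<in>{-1, 0, 1}. coord_wt \<rho> (\<mu> i) u * (if i = j then \<bar>u\<bar> else if i = k then \<bar>u\<bar> else 1))
     = (if i = j then \<rho> else 1) * (if i = k then \<rho> else 1)" for i
    using assms by (simp add: coord_wt_def field_simps)
  show ?thesis
    using sum_data_wt_prod[of \<rho> d \<mu> "\<lambda>i u. if i = j then \<bar>u\<bar> else if i = k then \<bar>u\<bar> else 1"] assms
    unfolding 1 2 by (simp add: prod.distrib prod.delta power2_eq_square)
qed

text \<open>Flipping the sign of coordinate \<open>j\<close> is an involution of
  \<open>ternary d\<close>. The weight of that coordinate times its centred value is
  \<open>\<rho> * (1 - (\<mu> j)\<^sup>2) / 2\<close> at 1, the negative of this at -1, and 0 at 0,
  so the summand is odd under the flip. The factor \<open>h\<close> may still depend on whether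
  \<open>z j\<close> is zero, as the normalisation of the loss does.\<close>

lemma sum_data_wt_centred:
  assumes "j < d" and h: "\<And>z. h (z(j := - z j)) = h z"
  shows "(\<Sum>z\<in>ternary d. data_wt \<rho> d \<mu> z * (centred \<mu> z j * h z)) = 0"
proof -
  define fl where "fl = (\<lambda>z :: nat \<Rightarrow> real. z(j := - z j))"
  define F where "F z = data_wt \<rho> d \<mu> z * (centred \<mu> z j * h z)" for z
  have "fl ` ternary d \<subseteq> ternary d"
  proof (rule image_subsetI)
    fix z assume z: "z \<in> ternary d"
    have "- z j \<in> {-1, 0, 1}" using ternaryD[OF z assms(1)] by (elim disjE) simp_all
    then show "fl z \<in> ternary d"
      using z assms(1) unfolding fl_def ternary_def PiE_iff by (simp add: extensional_def)
  qed
  then have bij: "bij_betw fl (ternary d) (ternary d)"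
    by (intro bij_betw_byWitness[where f' = fl]) (simp_all add: fl_def)
  have odd: "F (fl z) = - F z" if "z \<in> ternary d" for z
  proof -
    have *: "data_wt \<rho> d \<mu> y = coord_wt \<rho> (\<mu> j) (y j) * (\<Prod>k\<in>{..<d} - {j}. coord_wt \<rho> (\<mu> k) (y k))" for y
      unfolding data_wt_def using assms(1) by (subst prod.remove[of _ j]) auto
    have "(\<Prod>k\<in>{..<d} - {j}. coord_wt \<rho> (\<mu> k) (fl z k)) = (\<Prod>k\<in>{..<d} - {j}. coord_wt \<rho> (\<mu> k) (z k))"
      by (intro prod.cong) (auto simp: fl_def)
    moreover have "coord_wt \<rho> (\<mu> j) (- z j) * centred \<mu> (fl z) j = - (coord_wt \<rho> (\<mu> j) (z j) * centred \<mu> z j)"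
      using ternaryD[OF that assms(1)]
      by (elim disjE) (simp_all add: coord_wt_def centred_def fl_def field_simps)
    moreover have "F y = (coord_wt \<rho> (\<mu> j) (y j) * centred \<mu> y j) *
        ((\<Prod>k\<in>{..<d} - {j}. coord_wt \<rho> (\<mu> k) (y k)) * h y)" for y
      unfolding F_def * by (simp only: mult_ac)
    moreover have "fl z j = - z j" "h (fl z) = h z"
      using h by (simp_all add: fl_def)
    ultimately show ?thesis by simp
  qed
  have "sum F (ternary d) = (\<Sum>z\<in>ternary d. F (fl z))"
    using sum.reindex_bij_betw[OF bij, of F] by simp
  also have "\<dots> = - sum F (ternary d)"
    using odd by (simp add: sum_negf)
  finally show ?thesis unfolding F_def by simp
qed

text \<open>Centred coordinates are uncorrelated, since each is unchanged when the sign of another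
  is flipped, and coordinate \<open>j\<close> has variance
  \<open>\<rho> * (1 - (\<mu> j)\<^sup>2)\<close>.\<close>

lemma sum_data_wt_inner_centred_sq:
  assumes "0 \<le> \<rho>"
  shows "(\<Sum>z\<in>ternary d. data_wt \<rho> d \<mu> z * (\<Sum>j<d. x j * centred \<mu> z j)\<^sup>2) \<le> \<rho> * (\<Sum>j<d. (x j)\<^sup>2)"
proof -
  have diag: "(\<Sum>z\<in>ternary d. data_wt \<rho> d \<mu> z * (centred \<mu> z j)\<^sup>2) \<le> \<rho>" if "j < d" for j
  proof -
    have "(\<Sum>z\<in>ternary d. data_wt \<rho> d \<mu> z * (centred \<mu> z j)\<^sup>2) = \<rho> * (1 - (\<mu> j)\<^sup>2)"
      unfolding centred_def
      by (subst sum_data_wt_coord[OF that, where g = "\<lambda>u. (u - \<mu> j * \<bar>u\<bar>)\<^sup>2"])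
         (simp add: coord_wt_def field_simps power2_eq_square)
    also have "\<dots> \<le> \<rho> * 1" using assms by (intro mult_left_mono) auto
    finally show ?thesis by simp
  qed
  have off: "(\<Sum>z\<in>ternary d. data_wt \<rho> d \<mu> z * (centred \<mu> z j * centred \<mu> z k)) = 0"
    if "j < d" "j \<noteq> k" for j k
    using that by (intro sum_data_wt_centred) (auto simp: centred_def)
  have "(\<Sum>z\<in>ternary d. data_wt \<rho> d \<mu> z * (\<Sum>j<d. x j * centred \<mu> z j)\<^sup>2)
    = (\<Sum>z\<in>ternary d. \<Sum>j<d. \<Sum>k<d. x j * x k * (data_wt \<rho> d \<mu> z * (centred \<mu> z j * centred \<mu> z k)))"
    by (simp add: power2_eq_square sum_product sum_distrib_left mult_ac)
  also have "\<dots> = (\<Sum>j<d. \<Sum>k<d. x j * x k * (\<Sum>z\<in>ternary d. data_wt \<rho> d \<mu> z * (centred \<mu> z j * centred \<mu> z k)))"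
    unfolding sum_distrib_left by (subst sum.swap, intro sum.cong refl sum.swap)
  also have "\<dots> = (\<Sum>j<d. (x j)\<^sup>2 * (\<Sum>z\<in>ternary d. data_wt \<rho> d \<mu> z * (centred \<mu> z j)\<^sup>2))"
  proof (intro sum.cong refl)
    fix j assume j: "j \<in> {..<d}"
    have "(\<Sum>k<d. x j * x k * (\<Sum>z\<in>ternary d. data_wt \<rho> d \<mu> z * (centred \<mu> z j * centred \<mu> z k)))
      = (\<Sum>k<d. if k = j then (x j)\<^sup>2 * (\<Sum>z\<in>ternary d. data_wt \<rho> d \<mu> z * (centred \<mu> z j)\<^sup>2) else 0)"
      using off j by (intro sum.cong) (auto simp: power2_eq_square)
    then show "(\<Sum>k<d. x j * x k * (\<Sum>z\<in>ternary d. data_wt \<rho> d \<mu> z * (centred \<mu> z j * centred \<mu> z k)))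
      = (x j)\<^sup>2 * (\<Sum>z\<in>ternary d. data_wt \<rho> d \<mu> z * (centred \<mu> z j)\<^sup>2)"
      using j by simp
  qed
  also have "\<dots> \<le> (\<Sum>j<d. (x j)\<^sup>2 * \<rho>)"
    using diag by (intro sum_mono mult_left_mono) auto
  also have "\<dots> = \<rho> * (\<Sum>j<d. (x j)\<^sup>2)"
    by (simp add: sum_distrib_left mult.commute)
  finally show ?thesis .
qed

lemma sum_data_wt_abs_centred:
  assumes "0 \<le> \<rho>" "\<rho> \<le> 1" "\<forall>j<d. \<bar>\<mu> j\<bar> \<le> 1"
  shows "(\<Sum>z\<in>ternary d. data_wt \<rho> d \<mu> z * (\<Sum>j<d. \<bar>centred \<mu> z j\<bar>)) \<le> 2 * (d * \<rho>)"
proof -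
  have 1: "(\<Sum>z\<in>ternary d. data_wt \<rho> d \<mu> z * \<bar>z j\<bar>) = \<rho>" if "j < d" for j
    by (subst sum_data_wt_coord[OF that, where g = abs]) (simp add: coord_wt_def field_simps)
  have c: "\<bar>centred \<mu> z j\<bar> \<le> 2 * \<bar>z j\<bar>" if "j < d" for z j
  proof -
    have "\<bar>\<mu> j * \<bar>z j\<bar>\<bar> \<le> 1 * \<bar>z j\<bar>"
      unfolding abs_mult using assms(3) that by (intro mult_mono) auto
    then show ?thesis unfolding centred_def by linarith
  qed
  have "(\<Sum>z\<in>ternary d. data_wt \<rho> d \<mu> z * (\<Sum>j<d. \<bar>centred \<mu> z j\<bar>))
     \<le> (\<Sum>z\<in>ternary d. data_wt \<rho> d \<mu> z * (\<Sum>j<d. 2 * \<bar>z j\<bar>))"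
    using c assms by (intro sum_mono mult_left_mono data_wt_nonneg) auto
  also have "\<dots> = (\<Sum>j<d. 2 * (\<Sum>z\<in>ternary d. data_wt \<rho> d \<mu> z * \<bar>z j\<bar>))"
    unfolding sum_distrib_left by (subst sum.swap) (simp add: mult_ac)
  also have "\<dots> = 2 * (d * \<rho>)" using 1 by simp
  finally show ?thesis .
qed

section \<open>Size of the mean gradient of the normalised loss\<close>

definition support_size :: "nat \<Rightarrow> (nat \<Rightarrow> real) \<Rightarrow> real" where
  "support_size d z = (\<Sum>j<d. \<bar>z j\<bar>)"

text \<open>The left side is the tangent at \<open>m\<close> of the convex function
  \<open>x powr (- g)\<close>. It replaces Jensen's inequality and leaves \<open>m\<close> free, so
  \<open>m\<close> need not be the exact mean.\<close>

lemma powr_neg_ge_tangent: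
  fixes x m g :: real
  assumes "0 < x" "0 < m" "0 \<le> g"
  shows "m powr (- g) * (1 + g - g * x / m) \<le> x powr (- g)"
proof -
  have "1 + g - g * x / m \<le> 1 + - g * ln (x / m)"
    using mult_left_mono[OF ln_le_minus_one[of "x / m"], of g] assms by (simp add: algebra_simps)
  also have "\<dots> \<le> exp (- g * ln (x / m))" by (rule exp_ge_add_one_self)
  also have "\<dots> = (x / m) powr (- g)" using assms by (simp add: powr_def)
  finally have "m powr (- g) * (1 + g - g * x / m) \<le> m powr (- g) * (x / m) powr (- g)"
    by (intro mult_left_mono) auto
  then show ?thesis using assms by (simp add: powr_divide)
qed

text \<open>Attenuation of the mean in coordinate \<open>j\<close>: the expected gradient of the
  loss in that coordinate is \<open>- \<mu> j\<close> times this number.\<close>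

definition signal :: "real \<Rightarrow> nat \<Rightarrow> real \<Rightarrow> (nat \<Rightarrow> real) \<Rightarrow> nat \<Rightarrow> real" where
  "signal \<rho> d g \<mu> j = (\<Sum>z\<in>ternary d. data_wt \<rho> d \<mu> z * (\<bar>z j\<bar> * support_size d z powr (- g)))"

text \<open>Given \<open>z j \<noteq> 0\<close>, the mean support size is
  \<open>1 + (d - 1) * \<rho>\<close>, hence at most \<open>m = 1 + d * \<rho>\<close>. The tangent
  at \<open>m\<close> is linear in the support size, so only first moments and pair moments of the
  absolute values enter.\<close>

lemma signal_ge:
  assumes "0 \<le> \<rho>" "\<rho> \<le> 1" "\<forall>j<d. \<bar>\<mu> j\<bar> \<le> 1" "0 \<le> g" "j < d"
  shows "\<rho> * (1 + d * \<rho>) powr (- g) \<le> signal \<rho> d g \<mu> j"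
proof -
  define m where "m = 1 + d * \<rho>"
  have m: "0 < m" "d * \<rho> < m" using assms unfolding m_def by (auto intro: add_pos_nonneg)
  have 1: "(\<Sum>z\<in>ternary d. data_wt \<rho> d \<mu> z * \<bar>z j\<bar>) = \<rho>"
    by (subst sum_data_wt_coord[OF assms(5), where g = abs]) (simp add: coord_wt_def field_simps)
  have 11: "(\<Sum>z\<in>ternary d. data_wt \<rho> d \<mu> z * (\<bar>z j\<bar> * \<bar>z j\<bar>)) = \<rho>"
    by (subst sum_data_wt_coord[OF assms(5), where g = "\<lambda>u. \<bar>u\<bar> * \<bar>u\<bar>"]) (simp add: coord_wt_def field_simps)
  have 2: "(\<Sum>z\<in>ternary d. data_wt \<rho> d \<mu> z * (\<bar>z j\<bar> * support_size d z)) \<le> \<rho> * m"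
  proof -
    have "(\<Sum>z\<in>ternary d. data_wt \<rho> d \<mu> z * (\<bar>z j\<bar> * support_size d z))
       = (\<Sum>k<d. \<Sum>z\<in>ternary d. data_wt \<rho> d \<mu> z * (\<bar>z j\<bar> * \<bar>z k\<bar>))"
      unfolding support_size_def sum_distrib_left by (rule sum.swap)
    also have "\<dots> = \<rho> + (\<Sum>k\<in>{..<d} - {j}. \<rho>\<^sup>2)"
      using assms(5) 11 sum_data_wt_abs_pair[of j d _ \<rho> \<mu>] by (subst sum.remove[of _ j]) auto
    also have "\<dots> \<le> \<rho> + d * \<rho>\<^sup>2"
      using assms(5) by (auto intro!: mult_right_mono)
    also have "\<dots> = \<rho> * m" unfolding m_def by (simp add: power2_eq_square algebra_simps)
    finally show ?thesis .
  qed
  have "\<rho> * m powr (- g) \<le> m powr (- g) * ((1 + g) * \<rho> - g / m * (\<rho> * m))"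
    using m by (simp add: algebra_simps)
  also have "\<dots> \<le> m powr (- g) * ((1 + g) * (\<Sum>z\<in>ternary d. data_wt \<rho> d \<mu> z * \<bar>z j\<bar>)
        - g / m * (\<Sum>z\<in>ternary d. data_wt \<rho> d \<mu> z * (\<bar>z j\<bar> * support_size d z)))"
    unfolding 1 using m assms by (intro mult_left_mono diff_left_mono 2) auto
  also have "\<dots> = (\<Sum>z\<in>ternary d. data_wt \<rho> d \<mu> z * (\<bar>z j\<bar> * (m powr (- g) * (1 + g - g * support_size d z / m))))"
    unfolding sum_distrib_left sum_subtractf[symmetric] by (intro sum.cong) (auto simp: algebra_simps)
  also have "\<dots> \<le> signal \<rho> d g \<mu> j"
    unfolding signal_def
  proof (rule sum_mono, rule mult_left_mono)
    fix z assume z: "z \<in> ternary d"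
    show "0 \<le> data_wt \<rho> d \<mu> z" using assms z by (intro data_wt_nonneg) auto
    show "\<bar>z j\<bar> * (m powr (- g) * (1 + g - g * support_size d z / m)) \<le> \<bar>z j\<bar> * support_size d z powr (- g)"
    \<comment> \<open>Both sides vanish for \<open>z j = 0\<close>; otherwise the support size is
      positive, as the tangent bound requires.\<close>
    proof (cases "z j = 0")
      case False
      then have "0 < support_size d z"
        unfolding support_size_def using assms(5) by (intro sum_pos2[of _ j]) auto
      then show ?thesis using m assms by (intro mult_left_mono powr_neg_ge_tangent) auto
    qed simp
  qed
  finally show ?thesis unfolding m_def .
qed

text \<open>The support size is invariant under sign flips, so \<open>z j\<close> may be replaced by
  \<open>\<mu> j * \<bar>z j\<bar>\<close> in the mean.\<close>

lemma sum_data_wt_signal: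
  assumes "j < d"
  shows "(\<Sum>z\<in>ternary d. data_wt \<rho> d \<mu> z * (z j * support_size d z powr (- g))) = \<mu> j * signal \<rho> d g \<mu> j"
proof -
  have "support_size d (z(j := - z j)) = support_size d z" for z
    unfolding support_size_def by (intro sum.cong) auto
  then have "(\<Sum>z\<in>ternary d. data_wt \<rho> d \<mu> z * (centred \<mu> z j * support_size d z powr (- g))) = 0"
    using assms by (intro sum_data_wt_centred) auto
  then show ?thesis
    unfolding signal_def centred_def
    by (simp add: algebra_simps sum_subtractf sum_distrib_left)
qed

section \<open>The fingerprinting identity\<close>

text \<open>The uniform law on [-1, 1], carried by the whole real line: integrands stay functions on
  the line, and the bound \<open>\<bar>t\<bar> \<le> 1\<close> holds almost everywhere.\<close>

definition unif :: "real measure" where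
  "unif = density lborel (\<lambda>t. ennreal (indicator {-1..1} t / 2))"

lemma sets_unif [simp, measurable_cong]: "sets unif = sets borel"
  and space_unif [simp]: "space unif = UNIV"
  by (simp_all add: unif_def)

lemma integral_unif:
  fixes f F :: "real \<Rightarrow> real"
  assumes f: "continuous_on UNIV f" and F: "\<And>t. (F has_real_derivative f t) (at t)"
  shows "integrable unif f" and "(\<integral>t. f t \<partial>unif) = (F 1 - F (-1)) / 2"
proof -
  have m [measurable]: "f \<in> borel_measurable borel"
    using f by (rule borel_measurable_continuous_onI)
  have c: "continuous_on {-1..1} f" using f continuous_on_subset by blast
  have i: "integrable lborel (\<lambda>t. indicator {-1..1} t *\<^sub>R f t)"
    using borel_integrable_atLeastAtMost'[OF c] by (simp add: set_integrable_def)
  have I: "(\<integral>t. indicator {-1..1} t *\<^sub>R f t \<partial>lborel) = F 1 - F (-1)"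
    by (rule integral_FTC_atLeastAtMost)
       (use F c in \<open>auto intro: has_field_derivative_at_within simp flip: has_real_derivative_iff_has_vector_derivative\<close>)
  have eq: "(indicator {-1..1} t / 2) *\<^sub>R f t = (indicator {-1..1} t *\<^sub>R f t) / 2" for t :: real by simp
  show "integrable unif f"
    unfolding unif_def by (subst integrable_density) (use i eq in auto)
  show "(\<integral>t. f t \<partial>unif) = (F 1 - F (-1)) / 2"
    unfolding unif_def by (subst integral_density) (use I eq in auto)
qed

lemma prob_space_unif: "prob_space unif"
proof
  have "ennreal (indicator {-1..1} t / 2) = ennreal (1/2) * indicator {-1..1} t" for t :: real
    by (cases "t \<in> {-1..1}") simp_all
  then have "emeasure unif (space unif) = (\<integral>\<^sup>+(t::real). ennreal (1/2) * indicator {-1..1} t \<partial>lborel)"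
    unfolding unif_def by (subst emeasure_density) simp_all
  also have "\<dots> = ennreal (1/2) * ennreal 2"
    by (subst nn_integral_cmult_indicator) auto
  also have "\<dots> = ennreal (1/2 * 2)"
    by (rule ennreal_mult[symmetric]) simp_all
  also have "\<dots> = 1" by simp
  finally show "emeasure unif (space unif) = 1" .
qed

lemma AE_unif: "AE t in unif. \<bar>t\<bar> \<le> 1"
  unfolding unif_def by (subst AE_density) (auto simp: indicator_def abs_le_iff)

interpretation unif: prob_space unif by (rule prob_space_unif)

interpretation unif_prod: product_prob_space "\<lambda>_. unif" "UNIV :: nat set" by standard

abbreviation cube_prior :: "nat \<Rightarrow> (nat \<Rightarrow> real) measure" where
  "cube_prior d \<equiv> PiM {..<d} (\<lambda>_. unif)"

lemma prob_space_cube_prior: "prob_space (cube_prior d)"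
  by (intro prob_space_PiM prob_space_unif)

lemma AE_cube_prior: "AE \<mu> in cube_prior d. \<forall>j<d. \<bar>\<mu> j\<bar> \<le> 1"
proof -
  have "AE \<mu> in cube_prior d. \<forall>j\<in>{..<d}. \<bar>\<mu> j\<bar> \<le> 1"
    by (intro AE_finite_allI AE_PiM_component prob_space_unif AE_unif) auto
  then show ?thesis by eventually_elim simp
qed

lemma integral_cube_prior_sq:
  assumes "j < d"
  shows "integrable (cube_prior d) (\<lambda>\<mu>. (\<mu> j)\<^sup>2)" "(\<integral>\<mu>. (\<mu> j)\<^sup>2 \<partial>cube_prior d) = 1 / 3"
proof -
  define h where "h k = (if k = j then (\<lambda>t. t\<^sup>2) else (\<lambda>_. 1 :: real))" for k
  have eq: "(\<Prod>k<d. h k (\<mu> k)) = (\<mu> j)\<^sup>2" for \<mu> :: "nat \<Rightarrow> real"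
    using assms by (simp add: h_def if_distrib[of "\<lambda>f. f _"] prod.delta)
  have 1: "integrable unif (\<lambda>t. t\<^sup>2)" "(\<integral>t. t\<^sup>2 \<partial>unif) = 1/3"
    by (rule integral_unif[where F = "\<lambda>t. t ^ 3 / 3"];
        auto intro!: continuous_intros derivative_eq_intros)
       (subst integral_unif[where F = "\<lambda>t. t ^ 3 / 3"];
        auto intro!: continuous_intros derivative_eq_intros)
  have i: "integrable unif (h k)" for k using 1 by (cases "k = j") (simp_all add: h_def)
  have I: "(\<integral>t. h k t \<partial>unif) = (if k = j then 1 / 3 else 1)" for k
    using 1 by (cases "k = j") (simp_all add: h_def unif.prob_space[simplified])
  show "integrable (cube_prior d) (\<lambda>\<mu>. (\<mu> j)\<^sup>2)"
    using unif_prod.product_integrable_prod[of "{..<d}" h] i by (simp add: eq)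
  show "(\<integral>\<mu>. (\<mu> j)\<^sup>2 \<partial>cube_prior d) = 1 / 3"
    using unif_prod.product_integral_prod[of "{..<d}" h] i assms by (simp add: eq I prod.delta)
qed

text \<open>Each factor has logarithmic derivative
  \<open>(u - t * \<bar>u\<bar>) / (1 - t\<^sup>2)\<close>, and these add up over the product.
  Clearing the denominator keeps the identity meaningful at the endpoints, where weights
  vanish.\<close>

lemma coord_wt_score:
  fixes u :: "nat \<Rightarrow> real"
  assumes "\<And>i. i < n \<Longrightarrow> u i = -1 \<or> u i = 0 \<or> u i = 1"
  shows "\<exists>D. ((\<lambda>t. \<Prod>i<n. coord_wt \<rho> t (u i)) has_real_derivative D) (at t) \<and>
    (1 - t\<^sup>2) * D = (\<Prod>i<n. coord_wt \<rho> t (u i)) * (\<Sum>i<n. u i - t * \<bar>u i\<bar>)"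
  using assms
proof (induction n)
  case 0
  show ?case by (intro exI[of _ 0]) simp
next
  case (Suc n)
  then obtain D where D: "((\<lambda>t. \<Prod>i<n. coord_wt \<rho> t (u i)) has_real_derivative D) (at t)"
    "(1 - t\<^sup>2) * D = (\<Prod>i<n. coord_wt \<rho> t (u i)) * (\<Sum>i<n. u i - t * \<bar>u i\<bar>)" by auto
  define v where "v = (if u n = 0 then 0 else \<rho> * u n / 2)"
  have v: "((\<lambda>t. coord_wt \<rho> t (u n)) has_real_derivative v) (at t)"
    unfolding coord_wt_def v_def
    by (cases "u n = 0") (auto intro!: derivative_eq_intros)
  have v': "(1 - t\<^sup>2) * v = coord_wt \<rho> t (u n) * (u n - t * \<bar>u n\<bar>)"
    unfolding v_def coord_wt_def using Suc.prems[OF lessI]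
    by (elim disjE) (simp_all add: field_simps power2_eq_square)
  define P where "P = (\<Prod>i<n. coord_wt \<rho> t (u i))"
  show ?case
  proof (intro exI conjI)
    show "((\<lambda>t. \<Prod>i<Suc n. coord_wt \<rho> t (u i)) has_real_derivative (D * coord_wt \<rho> t (u n) + v * P)) (at t)"
      using DERIV_mult[OF D(1) v] by (simp add: P_def)
    have "(1 - t\<^sup>2) * (D * coord_wt \<rho> t (u n) + v * P)
      = ((1 - t\<^sup>2) * D) * coord_wt \<rho> t (u n) + ((1 - t\<^sup>2) * v) * P" by (simp add: algebra_simps)
    also have "\<dots> = P * coord_wt \<rho> t (u n) * ((\<Sum>i<n. u i - t * \<bar>u i\<bar>) + (u n - t * \<bar>u n\<bar>))"
      unfolding D(2) v' P_def by (simp add: algebra_simps)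
    finally show "(1 - t\<^sup>2) * (D * coord_wt \<rho> t (u n) + v * P)
      = (\<Prod>i<Suc n. coord_wt \<rho> t (u i)) * (\<Sum>i<Suc n. u i - t * \<bar>u i\<bar>)"
      by (simp add: P_def)
  qed
qed

lemma continuous_on_coord_wt [continuous_intros]: "continuous_on A (\<lambda>t. coord_wt \<rho> t u)"
  unfolding coord_wt_def by (cases "u = 0") (auto intro!: continuous_intros)

text \<open>By the score identity \<open>h\<close> is the derivative of \<open>1 - t\<^sup>2\<close>
  times the likelihood, which is zero at both ends of [-1, 1]. The term \<open>- 2 * t\<close> comes
  from differentiating \<open>1 - t\<^sup>2\<close>.\<close>

lemma integral_unif_score:
  fixes u :: "nat \<Rightarrow> real" and \<rho> :: real
  assumes u: "\<And>i. i < n \<Longrightarrow> u i = -1 \<or> u i = 0 \<or> u i = 1"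
  defines "h \<equiv> (\<lambda>t. (\<Prod>i<n. coord_wt \<rho> t (u i)) * ((\<Sum>i<n. u i - t * \<bar>u i\<bar>) - 2 * t))"
  shows "integrable unif h" "(\<integral>t. h t \<partial>unif) = 0"
proof -
  let ?F = "\<lambda>t. (1 - t\<^sup>2) * (\<Prod>i<n. coord_wt \<rho> t (u i))"
  have c: "continuous_on UNIV h"
    unfolding h_def by (intro continuous_intros)
  have F: "(?F has_real_derivative h t) (at t)" for t
  proof -
    obtain D where D: "((\<lambda>t. \<Prod>i<n. coord_wt \<rho> t (u i)) has_real_derivative D) (at t)"
      "(1 - t\<^sup>2) * D = (\<Prod>i<n. coord_wt \<rho> t (u i)) * (\<Sum>i<n. u i - t * \<bar>u i\<bar>)"
      using coord_wt_score[of n u \<rho> t] u by blast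
    have "(?F has_real_derivative ((- (2 * t)) * (\<Prod>i<n. coord_wt \<rho> t (u i)) + D * (1 - t\<^sup>2))) (at t)"
      by (intro DERIV_mult D) (auto intro!: derivative_eq_intros)
    moreover have "(- (2 * t)) * (\<Prod>i<n. coord_wt \<rho> t (u i)) + D * (1 - t\<^sup>2) = h t"
      using D(2) by (simp add: h_def algebra_simps)
    ultimately show ?thesis by simp
  qed
  show "integrable unif h" "(\<integral>t. h t \<partial>unif) = 0"
    using integral_unif[OF c F] by simp_all
qed

definition sample_wt :: "real \<Rightarrow> nat \<Rightarrow> nat \<Rightarrow> (nat \<Rightarrow> real) \<Rightarrow> (nat \<Rightarrow> nat \<Rightarrow> real) \<Rightarrow> real" where
  "sample_wt \<rho> d n \<mu> S = (\<Prod>i<n. data_wt \<rho> d \<mu> (S i))"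

text \<open>Fingerprinting: \<open>(1 - t\<^sup>2) \<partial>\<^sub>t coord_wt \<rho> t u = (u - t \<bar>u\<bar>) coord_wt \<rho> t u\<close>, integrated by parts.\<close>

lemma integral_sample_wt_score:
  fixes \<rho> :: real
  assumes "j < d" and S: "S \<in> {..<n} \<rightarrow>\<^sub>E ternary d"
  defines "H \<equiv> (\<lambda>\<mu>. sample_wt \<rho> d n \<mu> S * ((\<Sum>i<n. centred \<mu> (S i) j) - 2 * \<mu> j))"
  shows "integrable (cube_prior d) H" "(\<integral>\<mu>. H \<mu> \<partial>cube_prior d) = 0"
proof -
  have u: "S i k = -1 \<or> S i k = 0 \<or> S i k = 1" if "i < n" "k < d" for i k
    using S that by (intro ternaryD) (auto dest: PiE_mem)
  \<comment> \<open>The likelihood of the whole sample factors over coordinates and the score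
    concerns only coordinate \<open>j\<close>. The prior is a product, so the factor for
    \<open>j\<close>, with integral zero, annihilates the rest.\<close>
  define h where "h k = (if k = j then (\<lambda>t. (\<Prod>i<n. coord_wt \<rho> t (S i k)) * ((\<Sum>i<n. S i k - t * \<bar>S i k\<bar>) - 2 * t))
      else (\<lambda>t. \<Prod>i<n. coord_wt \<rho> t (S i k)))" for k
  have swap: "sample_wt \<rho> d n \<mu> S = (\<Prod>k<d. \<Prod>i<n. coord_wt \<rho> (\<mu> k) (S i k))" for \<mu>
    unfolding sample_wt_def data_wt_def by (rule prod.swap)
  have eq: "H = (\<lambda>\<mu>. \<Prod>k<d. h k (\<mu> k))"
  proof
    fix \<mu>
    have "(\<Prod>k\<in>{..<d} - {j}. h k (\<mu> k)) = (\<Prod>k\<in>{..<d} - {j}. \<Prod>i<n. coord_wt \<rho> (\<mu> k) (S i k))"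
      by (intro prod.cong) (auto simp: h_def)
    then show "H \<mu> = (\<Prod>k<d. h k (\<mu> k))"
      unfolding H_def swap centred_def using assms(1)
      by (subst (1 2) prod.remove[of _ j]) (simp_all add: h_def)
  qed
  have i: "integrable unif (h k)" if "k < d" for k
  proof (cases "k = j")
    case True
    then show ?thesis
      using integral_unif_score(1)[of n "\<lambda>i. S i j" \<rho>] u assms(1) by (simp add: h_def)
  next
    case False
    have "integrable unif (\<lambda>t. \<Prod>i<n. coord_wt \<rho> t (S i k))"
    proof (rule unif.integrable_const_bound)
      show "AE t in unif. norm (\<Prod>i<n. coord_wt \<rho> t (S i k)) \<le> (\<Prod>i<n. \<bar>1 - \<rho>\<bar> + \<bar>\<rho>\<bar>)"
        using AE_unif
      proof eventually_elim
        case (elim t)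
        show ?case
          unfolding prod_norm[symmetric]
        proof (intro prod_mono conjI)
          fix i assume "i \<in> {..<n}"
          then have "S i k = -1 \<or> S i k = 0 \<or> S i k = 1" using u \<open>k < d\<close> by simp
          moreover have "\<bar>\<rho> * v\<bar> \<le> \<bar>1 - \<rho>\<bar> * 2 + \<bar>\<rho>\<bar> * 2" if "\<bar>v\<bar> \<le> 2" for v
            unfolding abs_mult by (rule order_trans[OF mult_left_mono[OF that abs_ge_zero]]) simp
          from this[of "1 + t"] this[of "1 - t"]
          have "\<bar>\<rho> * (1 + t)\<bar> \<le> \<bar>1 - \<rho>\<bar> * 2 + \<bar>\<rho>\<bar> * 2" "\<bar>\<rho> * (1 - t)\<bar> \<le> \<bar>1 - \<rho>\<bar> * 2 + \<bar>\<rho>\<bar> * 2"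
            using elim by auto
          ultimately show "norm (coord_wt \<rho> t (S i k)) \<le> \<bar>1 - \<rho>\<bar> + \<bar>\<rho>\<bar>"
            by (elim disjE) (simp_all add: coord_wt_def)
        qed simp
      qed
      show "(\<lambda>t. \<Prod>i<n. coord_wt \<rho> t (S i k)) \<in> borel_measurable unif"
        by (subst measurable_cong_sets[OF sets_unif refl], intro borel_measurable_continuous_onI continuous_intros)
    qed
    then show ?thesis using False by (simp add: h_def)
  qed
  show "integrable (cube_prior d) H"
    unfolding eq using i by (intro unif_prod.product_integrable_prod) auto
  have "(\<integral>\<mu>. H \<mu> \<partial>cube_prior d) = (\<Prod>k<d. \<integral>t. h k t \<partial>unif)"
    unfolding eq using i by (intro unif_prod.product_integral_prod) auto
  also have "\<dots> = 0"
    using assms(1) integral_unif_score(2)[of n "\<lambda>i. S i j" \<rho>] u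
    by (intro prod_zero bexI[of _ j]) (auto simp: h_def)
  finally show "(\<integral>\<mu>. H \<mu> \<partial>cube_prior d) = 0" .
qed

section \<open>The hard problem\<close>

definition cube :: "real \<Rightarrow> nat \<Rightarrow> (nat \<Rightarrow> real) set" where
  "cube r d = {..<d} \<rightarrow>\<^sub>E {-r..r}"

text \<open>With \<open>g = 1 - 1 / p\<close>, the reciprocal of the exponent conjugate to
  \<open>p\<close>, the power of the support size is the reciprocal of the dual norm of a nonzero
  sign vector \<open>z\<close>. The gradient then has dual norm 1 however sparse \<open>z\<close>
  is.\<close>

definition loss :: "real \<Rightarrow> nat \<Rightarrow> (nat \<Rightarrow> real) \<Rightarrow> (nat \<Rightarrow> real) \<Rightarrow> real" where
  "loss g d \<theta> z = - (\<Sum>j<d. \<theta> j * z j) * support_size d z powr (- g)"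

definition data_dist :: "real \<Rightarrow> nat \<Rightarrow> (nat \<Rightarrow> real) \<Rightarrow> (nat \<Rightarrow> real) measure" where
  "data_dist \<rho> d \<mu> = point_measure (ternary d) (\<lambda>z. ennreal (data_wt \<rho> d \<mu> z))"

lemma cubeD: "\<theta> \<in> cube r d \<Longrightarrow> j < d \<Longrightarrow> \<bar>\<theta> j\<bar> \<le> r"
  unfolding cube_def by (auto dest!: PiE_mem[of _ _ _ j] simp: abs_le_iff)

lemma cube_subset_space: "cube r d \<subseteq> space (Rd d)"
  unfolding cube_def space_PiM by (intro PiE_mono) auto

text \<open>Hoelder's inequality, from the weighted Young inequality applied termwise after
  normalising both vectors: \<open>W\<close> is the sum of the powers of \<open>w\<close>, and
  \<open>N\<close> is the support size of \<open>z\<close>.\<close>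

lemma loss_Lipschitz:
  assumes "1 < p" "z \<in> ternary d"
  shows "\<bar>\<Sum>j<d. w j * z j\<bar> * support_size d z powr (- (1 - 1 / p)) \<le> lp_norm p d w"
\<comment> \<open>Here \<open>W\<close> or \<open>N\<close> may be zero, so the normalisation is
  available only in the other case.\<close>
proof (cases "\<forall>j<d. w j * z j = 0")
  case True
  then have "(\<Sum>j<d. w j * z j) = 0" by (intro sum.neutral) auto
  then show ?thesis by (simp only: lp_norm_def) simp
next
  case False
  then obtain k where k: "k < d" "w k * z k \<noteq> 0" by auto
  define W where "W = (\<Sum>j<d. \<bar>w j\<bar> powr p)"
  define N where "N = support_size d z"
  define g where "g = 1 - 1 / p"
  have N: "N > 0" unfolding N_def support_size_def
    using k by (intro sum_pos2[of _ k]) auto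
  have W: "W > 0" unfolding W_def
    using k by (intro sum_pos2[of _ k]) auto
  have g: "0 \<le> g" "1 / p + g = 1" "0 \<le> 1 / p" unfolding g_def using assms by (auto simp: field_simps)
  have young: "\<bar>w j\<bar> * \<bar>z j\<bar> \<le> W powr (1 / p) * N powr g * (1 / p * (\<bar>w j\<bar> powr p / W) + g * (\<bar>z j\<bar> / N))"
    if "j < d" for j
  proof (cases "w j = 0 \<or> z j = 0")
    case True
    then show ?thesis using W N g by auto
  next
    case False
    have z: "\<bar>z j\<bar> = 1" using ternaryD[OF assms(2) that] False by auto
    have "(\<bar>w j\<bar> powr p / W) powr (1 / p) * (1 / N) powr g \<le> 1 / p * (\<bar>w j\<bar> powr p / W) + g * (1 / N)"
      using False W N g by (intro Youngs_inequality_0) auto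
    moreover have "(\<bar>w j\<bar> powr p / W) powr (1 / p) = \<bar>w j\<bar> / W powr (1 / p)"
      using W assms(1) False by (simp add: powr_divide powr_powr)
    moreover have "(1 / N) powr g = 1 / N powr g" using N by (simp add: powr_divide)
    ultimately show ?thesis using W N z by (simp add: field_simps)
  qed
  have "\<bar>\<Sum>j<d. w j * z j\<bar> \<le> (\<Sum>j<d. \<bar>w j\<bar> * \<bar>z j\<bar>)"
    by (rule order_trans[OF sum_abs]) (simp add: abs_mult)
  also have "\<dots> \<le> (\<Sum>j<d. W powr (1 / p) * N powr g * (1 / p * (\<bar>w j\<bar> powr p / W) + g * (\<bar>z j\<bar> / N)))"
    using young by (intro sum_mono) auto
  also have "\<dots> = W powr (1 / p) * N powr g * (1 / p * (W / W) + g * (N / N))"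
    unfolding sum_distrib_left[symmetric] sum.distrib W_def N_def support_size_def sum_divide_distrib by simp
  also have "\<dots> = W powr (1 / p) * N powr g" using W N g by simp
  finally have "\<bar>\<Sum>j<d. w j * z j\<bar> * N powr (- g) \<le> W powr (1 / p) * N powr g * N powr (- g)"
    by (intro mult_right_mono) auto
  also have "\<dots> = W powr (1 / p)" using N by (simp add: mult.assoc flip: powr_add)
  finally show ?thesis unfolding W_def N_def g_def lp_norm_def .
qed

text \<open>The half-width is chosen so that the corners of the cube have norm exactly 1. The
  problem depends on \<open>p\<close> and \<open>d\<close> only; density and privacy parameters
  enter through the data distributions, as the order of quantifiers in the theorem demands.\<close>

lemma lp_sco_problem_loss:
  assumes "1 < p" "d \<ge> 1"
  shows "lp_sco_problem p d (cube (real d powr (- (1 / p))) d) (count_space (ternary d)) (loss (1 - 1 / p) d)"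
proof -
  define r where "r = real d powr (- (1 / p))"
  have r: "0 \<le> r" unfolding r_def by simp
  have ball: "cube r d \<subseteq> lp_ball p d 1"
  proof
    fix x assume x: "x \<in> cube r d"
    have "(\<Sum>j<d. \<bar>x j\<bar> powr p) \<le> (\<Sum>j<d. r powr p)"
      using assms cubeD[OF x] by (intro sum_mono powr_mono2) auto
    also have "r powr p = real d powr (-1)"
      using assms by (simp only: r_def powr_powr) simp
    also have "(\<Sum>j<d. real d powr (-1)) = 1"
      using assms by (simp add: powr_neg_one)
    finally have "(\<Sum>j<d. \<bar>x j\<bar> powr p) powr (1 / p) \<le> 1 powr (1 / p)"
      using assms by (intro powr_mono2 sum_nonneg) auto
    then show "x \<in> lp_ball p d 1"
      using x cube_subset_space unfolding lp_ball_def lp_norm_def by auto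
  qed
  have ne: "(\<lambda>j\<in>{..<d}. 0) \<in> cube r d" using r unfolding cube_def by auto
  have conv: "convex_comb d t x y \<in> cube r d" if "x \<in> cube r d" "y \<in> cube r d" "t \<in> {0..1}" for x y t
    unfolding cube_def convex_comb_def
  proof (rule restrict_PiE_iff[THEN iffD2], rule ballI)
    fix j assume j: "j \<in> {..<d}"
    have "\<bar>(1 - t) * x j + t * y j\<bar> \<le> (1 - t) * \<bar>x j\<bar> + t * \<bar>y j\<bar>"
      using that(3) abs_triangle_ineq[of "(1 - t) * x j" "t * y j"] by (simp add: abs_mult)
    also have "\<dots> \<le> (1 - t) * r + t * r"
      using that(3) cubeD[OF that(1)] cubeD[OF that(2)] j by (intro add_mono mult_left_mono) auto
    finally show "(1 - t) * x j + t * y j \<in> {-r..r}" by (simp add: algebra_simps abs_le_iff)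
  qed
  have aff: "loss g d (convex_comb d t x y) z = (1 - t) * loss g d x z + t * loss g d y z" for g t x y z
  proof -
    have *: "(\<Sum>j<d. convex_comb d t x y j * z j) = (1 - t) * (\<Sum>j<d. x j * z j) + t * (\<Sum>j<d. y j * z j)"
      unfolding convex_comb_def sum_distrib_left sum.distrib[symmetric]
      by (intro sum.cong) (auto simp: algebra_simps)
    show ?thesis unfolding loss_def * by (simp add: algebra_simps)
  qed
  have int: "integrable D (f :: _ \<Rightarrow> real)" if "D \<in> space (prob_algebra (count_space (ternary d)))" for D f
  proof -
    have "prob_space D" "sets D = Pow (ternary d)" using that by (auto simp: space_prob_algebra)
    moreover from this(2) have "space D = ternary d"
      using sets_eq_imp_space_eq[of D "count_space (ternary d)"] by simp
    ultimately show ?thesis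
      by (intro integral_finite_space(1)) (auto simp: prob_space.finite_measure)
  qed
  have lip: "\<bar>loss (1 - 1 / p) d x z - loss (1 - 1 / p) d y z\<bar> \<le> lp_norm p d (\<lambda>i. x i - y i)"
    if "z \<in> ternary d" for x y z
  proof -
    have "loss (1 - 1 / p) d x z - loss (1 - 1 / p) d y z
        = - ((\<Sum>j<d. (x j - y j) * z j) * support_size d z powr (- (1 - 1 / p)))"
      by (simp add: loss_def left_diff_distrib sum_subtractf)
    then show ?thesis
      using loss_Lipschitz[OF assms(1) that, of "\<lambda>i. x i - y i"] by (simp add: abs_mult)
  qed
  show ?thesis
    unfolding lp_sco_problem_def sco_problem_def r_def[symmetric]
    using cube_subset_space[of r d] ne conv ball int lip by (auto simp: aff)
qed

section \<open>Averages over data drawn from the hard distributions\<close>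

lemma data_dist:
  assumes "0 \<le> \<rho>" "\<rho> \<le> 1" "\<forall>j<d. \<bar>\<mu> j\<bar> \<le> 1"
  shows "prob_space (data_dist \<rho> d \<mu>)" "space (data_dist \<rho> d \<mu>) = ternary d"
    "sets (data_dist \<rho> d \<mu>) = Pow (ternary d)"
    "data_dist \<rho> d \<mu> \<in> space (prob_algebra (count_space (ternary d)))"
    "\<And>z. z \<in> ternary d \<Longrightarrow> measure (data_dist \<rho> d \<mu>) {z} = data_wt \<rho> d \<mu> z"
proof -
  have nn: "0 \<le> data_wt \<rho> d \<mu> z" if "z \<in> ternary d" for z
    using assms that by (intro data_wt_nonneg) auto
  show P: "prob_space (data_dist \<rho> d \<mu>)"
    unfolding data_dist_def
    using nn sum_data_wt[of \<rho> d \<mu>] by (intro prob_space_point_measure) auto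
  show "space (data_dist \<rho> d \<mu>) = ternary d" "sets (data_dist \<rho> d \<mu>) = Pow (ternary d)"
    by (simp_all add: data_dist_def space_point_measure sets_point_measure)
  then show "data_dist \<rho> d \<mu> \<in> space (prob_algebra (count_space (ternary d)))"
    using P by (simp add: space_prob_algebra)
  show "measure (data_dist \<rho> d \<mu>) {z} = data_wt \<rho> d \<mu> z" if "z \<in> ternary d" for z
    using that nn[OF that] unfolding data_dist_def
    by (simp add: measure_def emeasure_point_measure_finite2)
qed

lemma integral_datasets:
  assumes "0 \<le> \<rho>" "\<rho> \<le> 1" "\<forall>j<d. \<bar>\<mu> j\<bar> \<le> 1"
  shows "(\<integral>S. G S \<partial>datasets n (data_dist \<rho> d \<mu>)) = (\<Sum>S\<in>{..<n} \<rightarrow>\<^sub>E ternary d. sample_wt \<rho> d n \<mu> S * G S)"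
proof -
  note D = data_dist[OF assms]
  note P = PiM_finite_discrete[OF finite_lessThan[of n] finite_ternary D(1,2,3)]
  have fin: "finite ({..<n} \<rightarrow>\<^sub>E ternary d)" by (intro finite_PiE) auto
  have "(\<integral>S. G S \<partial>datasets n (data_dist \<rho> d \<mu>))
    = (\<Sum>S\<in>{..<n} \<rightarrow>\<^sub>E ternary d. measure (datasets n (data_dist \<rho> d \<mu>)) {S} * G S)"
    using integral_finite_space(2)[of "datasets n (data_dist \<rho> d \<mu>)" G] P fin
    by (simp add: prob_space.finite_measure)
  also have "\<dots> = (\<Sum>S\<in>{..<n} \<rightarrow>\<^sub>E ternary d. sample_wt \<rho> d n \<mu> S * G S)"
  proof (intro sum.cong refl)
    fix S assume S: "S \<in> {..<n} \<rightarrow>\<^sub>E ternary d"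
    then show "measure (datasets n (data_dist \<rho> d \<mu>)) {S} * G S = sample_wt \<rho> d n \<mu> S * G S"
      using P(4)[OF S] D(5) by (auto simp: sample_wt_def dest: PiE_mem intro!: prod.cong)
  qed
  finally show ?thesis .
qed

lemma risk_data_dist:
  assumes "0 \<le> \<rho>" "\<rho> \<le> 1" "\<forall>j<d. \<bar>\<mu> j\<bar> \<le> 1"
  shows "risk (loss g d) (data_dist \<rho> d \<mu>) \<theta> = - (\<Sum>j<d. \<theta> j * (\<mu> j * signal \<rho> d g \<mu> j))"
proof -
  note D = data_dist[OF assms]
  have "risk (loss g d) (data_dist \<rho> d \<mu>) \<theta> = (\<Sum>z\<in>ternary d. data_wt \<rho> d \<mu> z * loss g d \<theta> z)"
    unfolding risk_def using integral_finite_space(2)[of "data_dist \<rho> d \<mu>" "loss g d \<theta>"] D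
    by (simp add: prob_space.finite_measure)
  also have "\<dots> = - (\<Sum>z\<in>ternary d. \<Sum>j<d. \<theta> j * (data_wt \<rho> d \<mu> z * (z j * support_size d z powr (- g))))"
    unfolding loss_def sum_negf[symmetric]
    by (intro sum.cong refl) (simp add: sum_distrib_left sum_distrib_right mult_ac sum_negf)
  also have "\<dots> = - (\<Sum>j<d. \<theta> j * (\<Sum>z\<in>ternary d. data_wt \<rho> d \<mu> z * (z j * support_size d z powr (- g))))"
    unfolding sum_distrib_left by (subst sum.swap) simp
  also have "\<dots> = - (\<Sum>j<d. \<theta> j * (\<mu> j * signal \<rho> d g \<mu> j))"
    using sum_data_wt_signal by (intro arg_cong[where f = uminus] sum.cong) auto
  finally show ?thesis .
qed

lemma sum_sample_wt: "(\<Sum>S\<in>{..<n} \<rightarrow>\<^sub>E ternary d. sample_wt \<rho> d n \<mu> S) = 1"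
  unfolding sample_wt_def
  by (subst prod_sum_PiE[symmetric]) (simp_all add: sum_data_wt)

lemma sample_wt_nonneg:
  assumes "0 \<le> \<rho>" "\<rho> \<le> 1" "\<forall>j<d. \<bar>\<mu> j\<bar> \<le> 1" "S \<in> {..<n} \<rightarrow>\<^sub>E ternary d"
  shows "0 \<le> sample_wt \<rho> d n \<mu> S"
  unfolding sample_wt_def using assms by (intro prod_nonneg ballI data_wt_nonneg) (auto dest: PiE_mem)

section \<open>Accuracy and privacy\<close>

text \<open>The loss is linear, so the risk of a randomised output depends only on its mean;
  division by \<open>r\<close> rescales the cube to side [-1, 1].\<close>

definition coord_mean :: "real \<Rightarrow> ((nat \<Rightarrow> 'z) \<Rightarrow> (nat \<Rightarrow> real) measure) \<Rightarrow> (nat \<Rightarrow> 'z) \<Rightarrow> nat \<Rightarrow> real" where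
  "coord_mean r A S j = (\<integral>\<theta>. \<theta> j / r \<partial>A S)"

lemma algorithm_output:
  assumes "learning_algorithm d n (cube r d) Z A" "S \<in> space (datasets n Z)"
  shows "prob_space (A S)" "sets (A S) = sets (param_space d (cube r d))" "space (A S) = cube r d"
    "\<And>j. j < d \<Longrightarrow> (\<lambda>\<theta>. \<theta> j) \<in> borel_measurable (A S)"
    "\<And>j. j < d \<Longrightarrow> integrable (A S) (\<lambda>\<theta>. \<theta> j)"
proof -
  have *: "A S \<in> space (prob_algebra (param_space d (cube r d)))"
    using assms unfolding learning_algorithm_def by (rule Pi_mem)
  show P: "prob_space (A S)" and s: "sets (A S) = sets (param_space d (cube r d))"
    using * by (auto simp: space_prob_algebra)
  show sp: "space (A S) = cube r d"
    using sets_eq_imp_space_eq[OF s] cube_subset_space[of r d] by (simp add: space_restrict_space Int_absorb2)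
  fix j assume j: "j < d"
  have "(\<lambda>\<theta>. \<theta> j) \<in> borel_measurable (param_space d (cube r d))"
    using j by (intro measurable_restrict_space1 measurable_component_singleton) auto
  then show m: "(\<lambda>\<theta>. \<theta> j) \<in> borel_measurable (A S)"
    using measurable_cong_sets[OF s refl] by blast
  interpret prob_space "A S" by (rule P)
  show "integrable (A S) (\<lambda>\<theta>. \<theta> j)"
    using m cubeD[OF _ j, of _ r] sp by (intro integrable_const_bound[where B = r] AE_I2) auto
qed

lemma abs_coord_mean_le:
  assumes "learning_algorithm d n (cube r d) Z A" "S \<in> space (datasets n Z)" "j < d" "0 < r"
  shows "\<bar>coord_mean r A S j\<bar> \<le> 1"
proof -
  note a = algorithm_output[OF assms(1,2)]
  interpret prob_space "A S" by (rule a)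
  have "norm (\<integral>\<theta>. \<theta> j / r \<partial>A S) \<le> (\<integral>\<theta>. norm (\<theta> j / r) \<partial>A S)"
    by (rule integral_norm_bound)
  also have "\<dots> \<le> (\<integral>\<theta>. 1 \<partial>A S)"
    using a(3) a(5)[OF assms(3)] assms(4) cubeD[OF _ assms(3), of _ r]
    by (intro integral_mono) (auto simp: divide_le_eq)
  finally show ?thesis by (simp add: coord_mean_def prob_space)
qed

text \<open>For a linear risk on a cube the excess is a sum over coordinates of
  \<open>r * signal \<rho> d g \<mu> j\<close> times the deficit
  \<open>\<bar>\<mu> j\<bar> - \<mu> j * coord_mean r A S j\<close>. Every deficit is nonnegative
  because the rescaled mean is at most 1 in absolute value, so each signal may be lowered to the
  common bound of \<open>signal_ge\<close>.\<close>

lemma learner_bound: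
  assumes \<rho>: "0 < \<rho>" "\<rho> \<le> 1" and \<mu>: "\<forall>j<d. \<bar>\<mu> j\<bar> \<le> 1" and r: "0 < r" and g: "0 \<le> g"
    and A: "learning_algorithm d n (cube r d) (count_space (ternary d)) A"
    and L: "is_learner \<alpha> n (cube r d) (count_space (ternary d)) (loss g d) A"
  shows "(\<Sum>S\<in>{..<n} \<rightarrow>\<^sub>E ternary d. sample_wt \<rho> d n \<mu> S * (\<Sum>j<d. \<bar>\<mu> j\<bar> - \<mu> j * coord_mean r A S j))
    \<le> \<alpha> / (r * (\<rho> * (1 + d * \<rho>) powr (- g)))"
proof -
  define T where "T = {..<n} \<rightarrow>\<^sub>E ternary d"
  define \<kappa> where "\<kappa> = \<rho> * (1 + d * \<rho>) powr (- g)"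
  define s where "s j = signal \<rho> d g \<mu> j" for j
  define R where "R = risk (loss g d) (data_dist \<rho> d \<mu>)"
  define m where "m = coord_mean r A"
  have \<rho>0: "0 \<le> \<rho>" using \<rho> by simp
  note D = data_dist[OF \<rho>0 \<rho>(2) \<mu>]
  have "0 < 1 + d * \<rho>" using \<rho> by (intro add_pos_nonneg) auto
  then have \<kappa>: "0 < \<kappa>" unfolding \<kappa>_def using \<rho> by auto
  have s: "\<kappa> \<le> s j" if "j < d" for j
    unfolding \<kappa>_def s_def using signal_ge[OF \<rho>0 \<rho>(2) \<mu> g that] .
  have R: "R \<theta> = - (\<Sum>j<d. \<theta> j * (\<mu> j * s j))" for \<theta>
    unfolding R_def s_def using risk_data_dist[OF \<rho>0 \<rho>(2) \<mu>] .
  have out: "(\<integral>\<theta>. R \<theta> \<partial>A S) = - (\<Sum>j<d. r * m S j * (\<mu> j * s j))" if "S \<in> T" for S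
  proof -
    have "S \<in> space (datasets n (count_space (ternary d)))" using that by (simp add: T_def space_PiM)
    note a = algorithm_output[OF A this]
    have "(\<integral>\<theta>. R \<theta> \<partial>A S) = - (\<Sum>j<d. \<integral>\<theta>. \<theta> j * (\<mu> j * s j) \<partial>A S)"
      unfolding R using a(5) by (simp add: Bochner_Integration.integral_sum)
    then show ?thesis using r by (simp add: m_def coord_mean_def)
  qed
  \<comment> \<open>The comparison point aligns every coordinate with the sign of
    \<open>\<mu> j\<close> and minimises the risk; an upper bound on the infimum suffices.\<close>
  have "(INF \<theta>\<in>cube r d. R \<theta>) \<le> R (\<lambda>j\<in>{..<d}. r * sgn (\<mu> j))"
  proof (rule cINF_lower)
    show "bdd_below (R ` cube r d)"
    proof (rule bdd_belowI2)
      fix \<theta> assume \<theta>: "\<theta> \<in> cube r d"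
      have "\<theta> j * (\<mu> j * s j) \<le> r * \<bar>\<mu> j * s j\<bar>" if "j < d" for j
        using mult_right_mono[OF cubeD[OF \<theta> that], of "\<bar>\<mu> j * s j\<bar>"] abs_ge_self[of "\<theta> j * (\<mu> j * s j)"]
        by (simp add: abs_mult)
      then show "- (\<Sum>j<d. r * \<bar>\<mu> j * s j\<bar>) \<le> R \<theta>"
        unfolding R neg_le_iff_le by (intro sum_mono) auto
    qed
    show "(\<lambda>j\<in>{..<d}. r * sgn (\<mu> j)) \<in> cube r d"
      unfolding cube_def using r by (auto simp: sgn_if)
  qed
  also have "\<dots> = - (\<Sum>j<d. r * \<bar>\<mu> j\<bar> * s j)"
    unfolding R by (intro arg_cong[where f = uminus] sum.cong) (auto simp: abs_sgn)
  finally have INF: "(INF \<theta>\<in>cube r d. R \<theta>) \<le> - (\<Sum>j<d. r * \<bar>\<mu> j\<bar> * s j)" .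
  have "(\<integral>S. (\<integral>\<theta>. R \<theta> \<partial>A S) \<partial>datasets n (data_dist \<rho> d \<mu>)) - (INF \<theta>\<in>cube r d. R \<theta>) \<le> \<alpha>"
    using L D(4) unfolding is_learner_def R_def by blast
  then have "(\<Sum>S\<in>T. sample_wt \<rho> d n \<mu> S * (\<integral>\<theta>. R \<theta> \<partial>A S)) + (\<Sum>j<d. r * \<bar>\<mu> j\<bar> * s j) \<le> \<alpha>"
    using INF unfolding integral_datasets[OF \<rho>0 \<rho>(2) \<mu>] T_def by linarith
  also have "(\<Sum>j<d. r * \<bar>\<mu> j\<bar> * s j) = (\<Sum>S\<in>T. sample_wt \<rho> d n \<mu> S * (\<Sum>j<d. r * \<bar>\<mu> j\<bar> * s j))"
    using sum_sample_wt[of \<rho> d n \<mu>] by (simp add: T_def flip: sum_distrib_right)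
  finally have "(\<Sum>S\<in>T. sample_wt \<rho> d n \<mu> S * ((\<integral>\<theta>. R \<theta> \<partial>A S) + (\<Sum>j<d. r * \<bar>\<mu> j\<bar> * s j))) \<le> \<alpha>"
    by (simp add: sum.distrib distrib_left)
  moreover have "r * \<kappa> * (\<Sum>j<d. \<bar>\<mu> j\<bar> - \<mu> j * m S j) \<le> (\<integral>\<theta>. R \<theta> \<partial>A S) + (\<Sum>j<d. r * \<bar>\<mu> j\<bar> * s j)"
    if S: "S \<in> T" for S
  proof -
    have "r * \<kappa> * (\<bar>\<mu> j\<bar> - \<mu> j * m S j) \<le> r * s j * (\<bar>\<mu> j\<bar> - \<mu> j * m S j)" if j: "j < d" for j
    proof -
      have "\<bar>m S j\<bar> \<le> 1"
        unfolding m_def using S A r j by (intro abs_coord_mean_le[where Z = "count_space (ternary d)"]) (auto simp: T_def space_PiM)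
      then have "\<bar>\<mu> j * m S j\<bar> \<le> \<bar>\<mu> j\<bar> * 1" unfolding abs_mult by (intro mult_left_mono) auto
      then have "0 \<le> \<bar>\<mu> j\<bar> - \<mu> j * m S j" by linarith
      then show ?thesis using s[OF j] r by (intro mult_right_mono mult_left_mono) auto
    qed
    then have "(\<Sum>j<d. r * \<kappa> * (\<bar>\<mu> j\<bar> - \<mu> j * m S j)) \<le> (\<Sum>j<d. r * s j * (\<bar>\<mu> j\<bar> - \<mu> j * m S j))"
      by (intro sum_mono) auto
    also have "\<dots> = (\<integral>\<theta>. R \<theta> \<partial>A S) + (\<Sum>j<d. r * \<bar>\<mu> j\<bar> * s j)"
      unfolding out[OF S] by (simp add: right_diff_distrib sum_subtractf mult_ac)
    finally show ?thesis by (simp add: sum_distrib_left)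
  qed
  then have "(\<Sum>S\<in>T. sample_wt \<rho> d n \<mu> S * (r * \<kappa> * (\<Sum>j<d. \<bar>\<mu> j\<bar> - \<mu> j * m S j)))
     \<le> (\<Sum>S\<in>T. sample_wt \<rho> d n \<mu> S * ((\<integral>\<theta>. R \<theta> \<partial>A S) + (\<Sum>j<d. r * \<bar>\<mu> j\<bar> * s j)))"
    using sample_wt_nonneg[OF \<rho>0 \<rho>(2) \<mu>] by (intro sum_mono mult_left_mono) (auto simp: T_def)
  moreover have "(\<Sum>S\<in>T. sample_wt \<rho> d n \<mu> S * (r * \<kappa> * (\<Sum>j<d. \<bar>\<mu> j\<bar> - \<mu> j * m S j)))
    = r * \<kappa> * (\<Sum>S\<in>T. sample_wt \<rho> d n \<mu> S * (\<Sum>j<d. \<bar>\<mu> j\<bar> - \<mu> j * m S j))"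
    by (subst sum_distrib_left) (simp add: mult_ac)
  ultimately have "r * \<kappa> * (\<Sum>S\<in>T. sample_wt \<rho> d n \<mu> S * (\<Sum>j<d. \<bar>\<mu> j\<bar> - \<mu> j * m S j)) \<le> \<alpha>" by linarith
  then show ?thesis
    using r \<kappa> unfolding T_def[symmetric] \<kappa>_def[symmetric] m_def[symmetric]
    by (simp add: pos_le_divide_eq mult.commute)
qed

section \<open>Exchanging a data point with a fresh copy\<close>

lemma sample_wt_exchange:
  assumes "i < n"
  shows "sample_wt \<rho> d n \<mu> (S(i := z)) * data_wt \<rho> d \<mu> (S i) = sample_wt \<rho> d n \<mu> S * data_wt \<rho> d \<mu> z"
proof -
  have "(\<Prod>k\<in>{..<n} - {i}. data_wt \<rho> d \<mu> ((S(i := z)) k)) = (\<Prod>k\<in>{..<n} - {i}. data_wt \<rho> d \<mu> (S k))"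
    by (intro prod.cong) auto
  then show ?thesis
    unfolding sample_wt_def using assms by (subst (1 2) prod.remove[of _ i]) (simp_all add: mult_ac)
qed

lemma PiE_lessThan_update:
  assumes "S \<in> {..<n} \<rightarrow>\<^sub>E X" "z \<in> X" "i < n"
  shows "S(i := z) \<in> {..<n} \<rightarrow>\<^sub>E X"
  using PiE_fun_upd[of z "\<lambda>_. X" i S "{..<n}"] assms by (simp add: insert_absorb)

text \<open>A sample together with one fresh point consists of independent draws from the same law,
  so swapping the fresh point with the point at \<open>i\<close> is an involution that preserves the
  joint weight.\<close>

lemma sum_resample:
  assumes "i < n"
  shows "(\<Sum>S\<in>{..<n} \<rightarrow>\<^sub>E ternary d. \<Sum>z\<in>ternary d. sample_wt \<rho> d n \<mu> S * data_wt \<rho> d \<mu> z * \<Phi> (S(i := z)) (S i))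
    = (\<Sum>S\<in>{..<n} \<rightarrow>\<^sub>E ternary d. \<Sum>z\<in>ternary d. sample_wt \<rho> d n \<mu> S * data_wt \<rho> d \<mu> z * \<Phi> S z)"
proof -
  define P where "P = ({..<n} \<rightarrow>\<^sub>E ternary d) \<times> ternary d"
  define sw where "sw p = ((fst p)(i := snd p), fst p i)" for p :: "(nat \<Rightarrow> nat \<Rightarrow> real) \<times> (nat \<Rightarrow> real)"
  define F where "F p = sample_wt \<rho> d n \<mu> (fst p) * data_wt \<rho> d \<mu> (snd p)" for p
  have inv: "sw (sw p) = p" for p
    unfolding sw_def by (simp only: fst_conv snd_conv fun_upd_upd fun_upd_same fun_upd_triv prod.collapse)
  have mem: "sw p \<in> P" if "p \<in> P" for p
  proof -
    have S: "fst p \<in> {..<n} \<rightarrow>\<^sub>E ternary d" and z: "snd p \<in> ternary d"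
      using that unfolding P_def mem_Times_iff by blast+
    have "fst p i \<in> ternary d" using PiE_mem[OF S] assms by blast
    then show ?thesis
      unfolding sw_def P_def using PiE_lessThan_update[OF S z assms] by blast
  qed
  have F: "F (sw p) = F p" for p
    unfolding F_def sw_def using sample_wt_exchange[OF assms] by simp
  have "(\<Sum>p\<in>P. F p * \<Phi> (fst (sw p)) (snd (sw p))) = (\<Sum>p\<in>P. F p * \<Phi> (fst p) (snd p))"
    by (rule sum.reindex_bij_witness[where i = sw and j = sw]) (simp_all only: inv mem F)
  then show ?thesis
    unfolding sum.cartesian_product P_def F_def sw_def by (simp add: case_prod_beta)
qed

text \<open>The Cauchy-Schwarz bound on the first absolute moment, in the form that a variance is
  nonnegative, combined with the second moment of the inner product.\<close>

lemma sum_data_wt_abs_inner_le_sqrt: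
  assumes "0 \<le> \<rho>" "\<rho> \<le> 1" "\<forall>j<d. \<bar>\<mu> j\<bar> \<le> 1" "\<forall>j<d. \<bar>x j\<bar> \<le> 1"
  shows "(\<Sum>z\<in>ternary d. data_wt \<rho> d \<mu> z * \<bar>\<Sum>j<d. x j * centred \<mu> z j\<bar>) \<le> sqrt (d * \<rho>)"
proof -
  define Y where "Y z = \<bar>\<Sum>j<d. x j * centred \<mu> z j\<bar>" for z
  define m where "m = (\<Sum>z\<in>ternary d. data_wt \<rho> d \<mu> z * Y z)"
  have "0 \<le> (\<Sum>z\<in>ternary d. data_wt \<rho> d \<mu> z * (Y z - m)\<^sup>2)"
    using assms by (intro sum_nonneg mult_nonneg_nonneg data_wt_nonneg) auto
  also have "\<dots> = (\<Sum>z\<in>ternary d. data_wt \<rho> d \<mu> z * (Y z)\<^sup>2) - 2 * m * m + m\<^sup>2 * (\<Sum>z\<in>ternary d. data_wt \<rho> d \<mu> z)"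
    by (subst (2) m_def) (simp add: power2_eq_square algebra_simps sum.distrib sum_subtractf sum_distrib_left)
  also have "\<dots> = (\<Sum>z\<in>ternary d. data_wt \<rho> d \<mu> z * (\<Sum>j<d. x j * centred \<mu> z j)\<^sup>2) - m\<^sup>2"
    by (simp add: sum_data_wt Y_def power2_eq_square)
  also have "\<dots> \<le> \<rho> * (\<Sum>j<d. (x j)\<^sup>2) - m\<^sup>2"
    using sum_data_wt_inner_centred_sq[OF assms(1)] by simp
  also have "\<dots> \<le> \<rho> * (\<Sum>j<d. 1) - m\<^sup>2"
    using assms by (intro diff_right_mono mult_left_mono sum_mono) (auto simp: abs_square_le_1)
  finally have "m\<^sup>2 \<le> d * \<rho>" by (simp add: mult.commute)
  then show ?thesis unfolding m_def[symmetric] Y_def[symmetric] by (rule real_le_rsqrt)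
qed

text \<open>The triangle inequality. This beats the square root bound when
  \<open>d * \<rho> < 1 / 4\<close>, that is, for data that are mostly zero vectors or nearly
  so.\<close>

lemma sum_data_wt_abs_inner_le:
  assumes "0 \<le> \<rho>" "\<rho> \<le> 1" "\<forall>j<d. \<bar>\<mu> j\<bar> \<le> 1" "\<forall>j<d. \<bar>x j\<bar> \<le> 1"
  shows "(\<Sum>z\<in>ternary d. data_wt \<rho> d \<mu> z * \<bar>\<Sum>j<d. x j * centred \<mu> z j\<bar>) \<le> 2 * (d * \<rho>)"
proof -
  have "\<bar>\<Sum>j<d. x j * centred \<mu> z j\<bar> \<le> (\<Sum>j<d. \<bar>centred \<mu> z j\<bar>)" for z
  proof (rule order_trans[OF sum_abs sum_mono])
    fix j assume "j \<in> {..<d}"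
    then show "\<bar>x j * centred \<mu> z j\<bar> \<le> \<bar>centred \<mu> z j\<bar>"
      using assms(4) mult_right_mono[of "\<bar>x j\<bar>" 1 "\<bar>centred \<mu> z j\<bar>"] by (simp add: abs_mult)
  qed
  then have "(\<Sum>z\<in>ternary d. data_wt \<rho> d \<mu> z * \<bar>\<Sum>j<d. x j * centred \<mu> z j\<bar>)
      \<le> (\<Sum>z\<in>ternary d. data_wt \<rho> d \<mu> z * (\<Sum>j<d. \<bar>centred \<mu> z j\<bar>))"
    using assms by (intro sum_mono mult_left_mono data_wt_nonneg) auto
  also have "\<dots> \<le> 2 * (d * \<rho>)" using assms by (intro sum_data_wt_abs_centred) auto
  finally show ?thesis .
qed

lemma diff_privateD:
  assumes "diff_private \<epsilon> \<delta> d n \<Theta> Z A" "S \<in> space (datasets n Z)" "S(i := z) \<in> space (datasets n Z)"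
    "i < n" "z \<noteq> S i" "M \<in> sets (param_space d \<Theta>)"
  shows "measure (A S) M \<le> exp \<epsilon> * measure (A (S(i := z))) M + \<delta>"
    and "measure (A (S(i := z))) M \<le> exp \<epsilon> * measure (A S) M + \<delta>"
proof -
  have "{k. k < n \<and> S k \<noteq> (S(i := z)) k} = {i}" "{k. k < n \<and> (S(i := z)) k \<noteq> S k} = {i}"
    using assms(4,5) by auto
  then have "card {k. k < n \<and> S k \<noteq> (S(i := z)) k} = 1" "card {k. k < n \<and> (S(i := z)) k \<noteq> S k} = 1"
    by simp_all
  then show "measure (A S) M \<le> exp \<epsilon> * measure (A (S(i := z))) M + \<delta>"
    "measure (A (S(i := z))) M \<le> exp \<epsilon> * measure (A S) M + \<delta>"
    using assms(1,2,3,6) unfolding diff_private_def by blast+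
qed

text \<open>Replacing the \<open>i\<close>-th data point by a fresh one makes the output independent of the old
  point, with which it is then uncorrelated; privacy bounds the change.\<close>

lemma privacy_bound:
  assumes \<rho>: "0 \<le> \<rho>" "\<rho> \<le> 1" and \<mu>: "\<forall>j<d. \<bar>\<mu> j\<bar> \<le> 1" and r: "0 < r"
    and A: "learning_algorithm d n (cube r d) (count_space (ternary d)) A"
    and DP: "diff_private \<epsilon> \<delta> d n (cube r d) (count_space (ternary d)) A"
    and \<epsilon>: "0 \<le> \<epsilon>" "\<epsilon> \<le> 1" and \<delta>: "0 \<le> \<delta>" and i: "i < n"
    and b: "\<And>x. \<forall>j<d. \<bar>x j\<bar> \<le> 1 \<Longrightarrow> (\<Sum>z\<in>ternary d. data_wt \<rho> d \<mu> z * \<bar>\<Sum>j<d. x j * centred \<mu> z j\<bar>) \<le> b"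
  shows "(\<Sum>S\<in>{..<n} \<rightarrow>\<^sub>E ternary d. sample_wt \<rho> d n \<mu> S * (\<Sum>j<d. coord_mean r A S j * centred \<mu> (S i) j))
    \<le> 2 * \<epsilon> * b + 4 * \<delta> * (d * \<rho>)"
proof -
  define T where "T = {..<n} \<rightarrow>\<^sub>E ternary d"
  define w where "w = data_wt \<rho> d \<mu>"
  define W where "W = sample_wt \<rho> d n \<mu>"
  define \<phi> where "\<phi> z \<theta> = (\<Sum>j<d. \<theta> j / r * centred \<mu> z j)" for z \<theta>
  define B where "B z = (\<Sum>j<d. \<bar>centred \<mu> z j\<bar>)" for z
  define \<Psi> where "\<Psi> S z = (\<integral>\<theta>. \<phi> z \<theta> \<partial>A S) + 2 * \<epsilon> * (\<integral>\<theta>. \<bar>\<phi> z \<theta>\<bar> \<partial>A S) + 2 * \<delta> * B z" for S z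
  have T: "S \<in> space (datasets n (count_space (ternary d)))" if "S \<in> T" for S
    using that by (simp add: T_def space_PiM)
  note out = algorithm_output[OF A T]
  have w0: "0 \<le> w z" if "z \<in> ternary d" for z unfolding w_def using data_wt_nonneg[OF \<rho> \<mu> that] .
  have W0: "0 \<le> W S" if "S \<in> T" for S unfolding W_def using sample_wt_nonneg[OF \<rho> \<mu>] that by (simp add: T_def)
  have w1: "sum w (ternary d) = 1" unfolding w_def by (rule sum_data_wt)
  have W1: "sum W T = 1" unfolding W_def T_def by (rule sum_sample_wt)
  have x1: "\<bar>\<theta> j / r\<bar> \<le> 1" if "\<theta> \<in> cube r d" "j < d" for \<theta> j
    using cubeD[OF that] r by (simp add: divide_le_eq)
  have int: "integrable (A S) (\<phi> z)" if "S \<in> T" for S z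
    unfolding \<phi>_def using out(5)[OF that] by (intro Bochner_Integration.integrable_sum) auto
  have mean: "(\<integral>\<theta>. \<phi> z \<theta> \<partial>A S) = (\<Sum>j<d. coord_mean r A S j * centred \<mu> z j)" if "S \<in> T" for S z
    unfolding \<phi>_def coord_mean_def using out(5)[OF that]
    by (subst Bochner_Integration.integral_sum) auto
  have \<phi>B: "\<bar>\<phi> z \<theta>\<bar> \<le> B z" if "\<theta> \<in> cube r d" for z \<theta>
    unfolding \<phi>_def B_def
  proof (rule order_trans[OF sum_abs sum_mono])
    fix j assume "j \<in> {..<d}"
    then show "\<bar>\<theta> j / r * centred \<mu> z j\<bar> \<le> \<bar>centred \<mu> z j\<bar>"
      using mult_right_mono[OF x1[OF that, of j], of "\<bar>centred \<mu> z j\<bar>"] by (simp add: abs_mult)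
  qed
  have B0: "0 \<le> B z" for z unfolding B_def by (intro sum_nonneg) auto
  have step: "(\<integral>\<theta>. \<phi> (S i) \<theta> \<partial>A S) \<le> \<Psi> (S(i := z)) (S i)" if S: "S \<in> T" and z: "z \<in> ternary d" for S z
  proof (cases "z = S i")
    \<comment> \<open>The datasets coincide, so privacy says nothing about them; the error terms in
      \<open>\<Psi>\<close> are nonnegative.\<close>
    case True
    then show ?thesis using \<epsilon> \<delta> B0 by (auto simp: \<Psi>_def intro!: add_nonneg_nonneg mult_nonneg_nonneg)
  next
    case False
    have S': "S(i := z) \<in> T" using S z i unfolding T_def by (intro PiE_lessThan_update)
    note o = out[OF S] and o' = out[OF S']
    note dp = diff_privateD[OF DP T[OF S] T[OF S'] i False]
    have "\<phi> (S i) \<in> borel_measurable (A (S(i := z)))" using int[OF S'] by auto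
    then show ?thesis
      unfolding \<Psi>_def using o(1,2) o'(1,2,3) dp \<phi>B \<epsilon> \<delta>
      by (intro integral_le_of_close) auto
  qed
  \<comment> \<open>For a parameter fixed independently of the point \<open>z\<close>, the
    correlation averages to zero.\<close>
  have zero: "(\<Sum>z\<in>ternary d. w z * \<phi> z \<theta>) = 0" for \<theta>
  proof -
    have "(\<Sum>z\<in>ternary d. w z * \<phi> z \<theta>) = (\<Sum>j<d. \<theta> j / r * (\<Sum>z\<in>ternary d. w z * (centred \<mu> z j * 1)))"
      unfolding \<phi>_def sum_distrib_left by (subst sum.swap) (simp add: mult_ac)
    also have "\<dots> = 0"
      unfolding w_def using sum_data_wt_centred[where h = "\<lambda>_. 1"] by (intro sum.neutral) auto
    finally show ?thesis .
  qed
  have inner: "(\<Sum>z\<in>ternary d. w z * \<Psi> S z) \<le> 2 * \<epsilon> * b + 4 * \<delta> * (d * \<rho>)" if S: "S \<in> T" for S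
  proof -
    interpret prob_space "A S" by (rule out(1)[OF S])
    have "(\<Sum>z\<in>ternary d. w z * (\<integral>\<theta>. \<phi> z \<theta> \<partial>A S)) = (\<integral>\<theta>. (\<Sum>z\<in>ternary d. w z * \<phi> z \<theta>) \<partial>A S)"
      using int[OF S] by (subst Bochner_Integration.integral_sum) auto
    then have 1: "(\<Sum>z\<in>ternary d. w z * (\<integral>\<theta>. \<phi> z \<theta> \<partial>A S)) = 0" by (simp add: zero)
    have "(\<Sum>z\<in>ternary d. w z * (\<integral>\<theta>. \<bar>\<phi> z \<theta>\<bar> \<partial>A S)) = (\<integral>\<theta>. (\<Sum>z\<in>ternary d. w z * \<bar>\<phi> z \<theta>\<bar>) \<partial>A S)"
      using int[OF S] by (subst Bochner_Integration.integral_sum) auto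
    also have "\<dots> \<le> (\<integral>\<theta>. b \<partial>A S)"
    proof (rule integral_mono)
      show "integrable (A S) (\<lambda>\<theta>. \<Sum>z\<in>ternary d. w z * \<bar>\<phi> z \<theta>\<bar>)"
        using int[OF S] by (intro Bochner_Integration.integrable_sum) auto
      fix \<theta> assume "\<theta> \<in> space (A S)"
      then show "(\<Sum>z\<in>ternary d. w z * \<bar>\<phi> z \<theta>\<bar>) \<le> b"
        unfolding w_def \<phi>_def using out(3)[OF S] x1 by (intro b) auto
    qed simp
    finally have 2: "(\<Sum>z\<in>ternary d. w z * (\<integral>\<theta>. \<bar>\<phi> z \<theta>\<bar> \<partial>A S)) \<le> b" by (simp add: prob_space)
    have 3: "(\<Sum>z\<in>ternary d. w z * B z) \<le> 2 * (d * \<rho>)"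
      unfolding w_def B_def by (rule sum_data_wt_abs_centred[OF \<rho> \<mu>])
    have "(\<Sum>z\<in>ternary d. w z * \<Psi> S z) = (\<Sum>z\<in>ternary d. w z * (\<integral>\<theta>. \<phi> z \<theta> \<partial>A S))
       + 2 * \<epsilon> * (\<Sum>z\<in>ternary d. w z * (\<integral>\<theta>. \<bar>\<phi> z \<theta>\<bar> \<partial>A S)) + 2 * \<delta> * (\<Sum>z\<in>ternary d. w z * B z)"
      unfolding \<Psi>_def sum_distrib_left sum.distrib[symmetric]
      by (intro sum.cong refl) (simp add: distrib_left mult_ac)
    also have "\<dots> \<le> 0 + 2 * \<epsilon> * b + 2 * \<delta> * (2 * (d * \<rho>))"
      unfolding 1 using 2 3 \<epsilon> \<delta> by (intro add_mono mult_left_mono) auto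
    finally show ?thesis by simp
  qed
  \<comment> \<open>The factor \<open>sum w (ternary d)\<close>, equal to 1, introduces the fresh
    point. Privacy moves the output to the dataset with that point inserted, and the exchange makes
    the tested point the fresh one.\<close>
  have "(\<Sum>S\<in>T. W S * (\<Sum>j<d. coord_mean r A S j * centred \<mu> (S i) j))
     = (\<Sum>S\<in>T. W S * (\<integral>\<theta>. \<phi> (S i) \<theta> \<partial>A S) * sum w (ternary d))"
    using mean w1 by (intro sum.cong) auto
  also have "\<dots> = (\<Sum>S\<in>T. \<Sum>z\<in>ternary d. W S * w z * (\<integral>\<theta>. \<phi> (S i) \<theta> \<partial>A S))"
    unfolding sum_distrib_left by (simp add: mult_ac)
  also have "\<dots> \<le> (\<Sum>S\<in>T. \<Sum>z\<in>ternary d. W S * w z * \<Psi> (S(i := z)) (S i))"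
    using step w0 W0 by (intro sum_mono mult_left_mono) auto
  also have "\<dots> = (\<Sum>S\<in>T. \<Sum>z\<in>ternary d. W S * w z * \<Psi> S z)"
    unfolding T_def W_def w_def by (rule sum_resample[OF i])
  also have "\<dots> = (\<Sum>S\<in>T. W S * (\<Sum>z\<in>ternary d. w z * \<Psi> S z))"
    by (simp add: sum_distrib_left mult.assoc)
  also have "\<dots> \<le> (\<Sum>S\<in>T. W S * (2 * \<epsilon> * b + 4 * \<delta> * (d * \<rho>)))"
    using inner W0 by (intro sum_mono mult_left_mono) auto
  also have "\<dots> = 2 * \<epsilon> * b + 4 * \<delta> * (d * \<rho>)"
    using W1 by (simp flip: sum_distrib_right)
  finally show ?thesis unfolding T_def W_def .
qed

section \<open>Combining fingerprinting, accuracy and privacy\<close>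

text \<open>Let \<open>H\<close> be the correlation of the output with all centred data points minus
  twice its correlation with \<open>\<mu>\<close>. Fingerprinting makes the prior mean of
  \<open>H\<close> zero. Pointwise, the two privacy terms contribute at most \<open>d / 4\<close>
  each, and accuracy makes the subtracted part at least \<open>2 * (\<Sum>j<d. (\<mu> j)\<^sup>2) -
  2 * (\<alpha> / \<kappa>)\<close>. Since \<open>(\<mu> j)\<^sup>2\<close> has mean 1/3, averaging
  gives \<open>0 \<le> d / 2 - 2 * (d / 3) + 2 * (\<alpha> / \<kappa>)\<close>, hence the factor
  1/12.\<close>

lemma learner_rate_bound:
  assumes \<rho>: "0 < \<rho>" "\<rho> \<le> 1" and r: "0 < r" and g: "0 \<le> g"
    and A: "learning_algorithm d n (cube r d) (count_space (ternary d)) A"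
    and DP: "diff_private \<epsilon> \<delta> d n (cube r d) (count_space (ternary d)) A"
    and L: "is_learner \<alpha> n (cube r d) (count_space (ternary d)) (loss g d) A"
    and \<epsilon>: "0 \<le> \<epsilon>" "\<epsilon> \<le> 1" and \<delta>: "0 \<le> \<delta>"
    and b: "2 * n * \<epsilon> * min (sqrt (d * \<rho>)) (2 * (d * \<rho>)) \<le> d / 4" and n\<delta>: "n * \<delta> \<le> 1 / 16"
  shows "r * (\<rho> * (1 + d * \<rho>) powr (- g)) * d / 12 \<le> \<alpha>"
proof -
  define T where "T = {..<n} \<rightarrow>\<^sub>E ternary d"
  define \<kappa> where "\<kappa> = r * (\<rho> * (1 + d * \<rho>) powr (- g))"
  define m where "m = coord_mean r A"
  define H where "H \<mu> = (\<Sum>S\<in>T. \<Sum>j<d. m S j * (sample_wt \<rho> d n \<mu> S * ((\<Sum>i<n. centred \<mu> (S i) j) - 2 * \<mu> j)))" for \<mu>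
  have \<rho>0: "0 \<le> \<rho>" using \<rho> by simp
  have "0 < 1 + d * \<rho>" using \<rho> by (intro add_pos_nonneg) auto
  then have \<kappa>: "0 < \<kappa>" unfolding \<kappa>_def using \<rho> r by auto
  have intH: "integrable (cube_prior d) H"
    unfolding H_def T_def
    by (intro Bochner_Integration.integrable_sum integrable_mult_right integral_sample_wt_score(1)) auto
  \<comment> \<open>The mean output on a fixed dataset does not depend on \<open>\<mu>\<close>, so
    it is a constant in front of each fingerprinting integral.\<close>
  have H0: "(\<integral>\<mu>. H \<mu> \<partial>cube_prior d) = 0"
  proof -
    have "(\<integral>\<mu>. H \<mu> \<partial>cube_prior d) = (\<Sum>S\<in>T. \<Sum>j<d. \<integral>\<mu>. m S j * (sample_wt \<rho> d n \<mu> S * ((\<Sum>i<n. centred \<mu> (S i) j) - 2 * \<mu> j)) \<partial>cube_prior d)"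
      unfolding H_def T_def
      by (subst Bochner_Integration.integral_sum;
          (intro Bochner_Integration.integrable_sum sum.cong refl Bochner_Integration.integral_sum integrable_mult_right integral_sample_wt_score(1))?) auto
    also have "\<dots> = 0"
      using integral_sample_wt_score(2)[of _ d _ n \<rho>] by (intro sum.neutral ballI) (simp add: T_def)
    finally show ?thesis .
  qed
  have le: "H \<mu> \<le> d / 2 - 2 * (\<Sum>j<d. (\<mu> j)\<^sup>2) + 2 * (\<alpha> / \<kappa>)" if \<mu>: "\<forall>j<d. \<bar>\<mu> j\<bar> \<le> 1" for \<mu>
  proof -
    define W where "W = sample_wt \<rho> d n \<mu>"
    define \<beta> where "\<beta> = min (sqrt (d * \<rho>)) (2 * (d * \<rho>))"
    have priv: "(\<Sum>S\<in>T. W S * (\<Sum>j<d. m S j * centred \<mu> (S i) j)) \<le> 2 * \<epsilon> * \<beta> + 4 * \<delta> * (d * \<rho>)"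
      if "i < n" for i
      unfolding T_def W_def m_def \<beta>_def
      using sum_data_wt_abs_inner_le_sqrt[OF \<rho>0 \<rho>(2) \<mu>] sum_data_wt_abs_inner_le[OF \<rho>0 \<rho>(2) \<mu>]
      by (intro privacy_bound[OF \<rho>0 \<rho>(2) \<mu> r A DP \<epsilon> \<delta> that]) simp
    have "(\<Sum>S\<in>T. W S * (\<Sum>j<d. \<bar>\<mu> j\<bar> - \<mu> j * m S j)) = (\<Sum>S\<in>T. W S * (\<Sum>j<d. \<bar>\<mu> j\<bar>) - W S * (\<Sum>j<d. \<mu> j * m S j))"
      by (simp add: sum_subtractf right_diff_distrib)
    also have "\<dots> = (\<Sum>j<d. \<bar>\<mu> j\<bar>) - (\<Sum>S\<in>T. W S * (\<Sum>j<d. \<mu> j * m S j))"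
      using sum_sample_wt[of \<rho> d n \<mu>] by (simp add: W_def T_def sum_subtractf flip: sum_distrib_right)
    finally have acc: "(\<Sum>j<d. \<bar>\<mu> j\<bar>) - (\<Sum>S\<in>T. W S * (\<Sum>j<d. \<mu> j * m S j)) \<le> \<alpha> / \<kappa>"
      using learner_bound[OF \<rho> \<mu> r g A L] unfolding T_def W_def \<kappa>_def m_def by linarith
    \<comment> \<open>Accuracy gives the absolute values; squares have a prior mean that is already
      computed.\<close>
    have sq: "(\<Sum>j<d. (\<mu> j)\<^sup>2) \<le> (\<Sum>j<d. \<bar>\<mu> j\<bar>)"
    proof (rule sum_mono)
      fix j assume "j \<in> {..<d}"
      then show "(\<mu> j)\<^sup>2 \<le> \<bar>\<mu> j\<bar>"
        using \<mu> mult_left_mono[of "\<bar>\<mu> j\<bar>" 1 "\<bar>\<mu> j\<bar>"] by (simp add: power2_eq_square flip: abs_mult)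
    qed
    have "H \<mu> = (\<Sum>S\<in>T. (\<Sum>i<n. W S * (\<Sum>j<d. m S j * centred \<mu> (S i) j)) - 2 * (W S * (\<Sum>j<d. \<mu> j * m S j)))"
      unfolding H_def W_def
    proof (intro sum.cong refl)
      fix S
      have "(\<Sum>i<n. sample_wt \<rho> d n \<mu> S * (\<Sum>j<d. m S j * centred \<mu> (S i) j))
          = (\<Sum>j<d. m S j * (sample_wt \<rho> d n \<mu> S * (\<Sum>i<n. centred \<mu> (S i) j)))"
        unfolding sum_distrib_left by (subst sum.swap) (simp add: mult_ac)
      then show "(\<Sum>j<d. m S j * (sample_wt \<rho> d n \<mu> S * ((\<Sum>i<n. centred \<mu> (S i) j) - 2 * \<mu> j)))
        = (\<Sum>i<n. sample_wt \<rho> d n \<mu> S * (\<Sum>j<d. m S j * centred \<mu> (S i) j)) - 2 * (sample_wt \<rho> d n \<mu> S * (\<Sum>j<d. \<mu> j * m S j))"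
        by (simp add: right_diff_distrib sum_subtractf sum_distrib_left mult_ac)
    qed
    also have "\<dots> = (\<Sum>i<n. \<Sum>S\<in>T. W S * (\<Sum>j<d. m S j * centred \<mu> (S i) j)) - 2 * (\<Sum>S\<in>T. W S * (\<Sum>j<d. \<mu> j * m S j))"
      unfolding sum_subtractf sum_distrib_left[of 2] by (subst sum.swap) simp
    also have "\<dots> \<le> (\<Sum>i<n. 2 * \<epsilon> * \<beta> + 4 * \<delta> * (d * \<rho>)) - 2 * ((\<Sum>j<d. (\<mu> j)\<^sup>2) - \<alpha> / \<kappa>)"
      using acc sq priv by (intro diff_mono sum_mono) auto
    also have "(\<Sum>i<n. 2 * \<epsilon> * \<beta> + 4 * \<delta> * (d * \<rho>)) = 2 * n * \<epsilon> * \<beta> + 4 * (n * \<delta>) * (d * \<rho>)"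
      by (simp add: algebra_simps)
    also have "4 * (n * \<delta>) * (d * \<rho>) \<le> 4 * (1 / 16) * (d * 1)"
      using n\<delta> \<delta> \<rho> mult_left_mono[OF \<rho>(2), of "real d"] by (intro mult_mono) auto
    finally show ?thesis using b unfolding \<beta>_def by (simp add: algebra_simps)
  qed
  interpret P: prob_space "cube_prior d" by (rule prob_space_cube_prior)
  have int2: "integrable (cube_prior d) (\<lambda>\<mu>. \<Sum>j<d. (\<mu> j)\<^sup>2)"
    using integral_cube_prior_sq(1) by (intro Bochner_Integration.integrable_sum) auto
  have "(\<integral>\<mu>. (\<Sum>j<d. (\<mu> j)\<^sup>2) \<partial>cube_prior d) = (\<Sum>j<d. \<integral>\<mu>. (\<mu> j)\<^sup>2 \<partial>cube_prior d)"
    using integral_cube_prior_sq(1) by (intro Bochner_Integration.integral_sum) auto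
  also have "\<dots> = (\<Sum>j<d. 1 / 3)"
    by (intro sum.cong refl integral_cube_prior_sq(2)) auto
  finally have "(\<integral>\<mu>. (\<Sum>j<d. (\<mu> j)\<^sup>2) \<partial>cube_prior d) = d / 3" by simp
  moreover have "(\<integral>\<mu>. H \<mu> \<partial>cube_prior d) \<le> (\<integral>\<mu>. d / 2 - 2 * (\<Sum>j<d. (\<mu> j)\<^sup>2) + 2 * (\<alpha> / \<kappa>) \<partial>cube_prior d)"
  proof (rule integral_mono_AE)
    show "AE \<mu> in cube_prior d. H \<mu> \<le> d / 2 - 2 * (\<Sum>j<d. (\<mu> j)\<^sup>2) + 2 * (\<alpha> / \<kappa>)"
      using AE_cube_prior[of d] by eventually_elim (rule le)
  qed (use intH int2 in auto)
  ultimately have "0 \<le> d / 2 - 2 * (d / 3) + 2 * (\<alpha> / \<kappa>)"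
    using int2 by (simp add: H0 P.prob_space)
  then have "d / 12 \<le> \<alpha> / \<kappa>" by (simp add: mult.commute)
  then show ?thesis using \<kappa> unfolding \<kappa>_def[symmetric] by (simp add: pos_le_divide_eq mult.commute)
qed

section \<open>Choice of the density of the data\<close>

text \<open>Privacy caps the density through a minimum, so satisfying either of its two branches is
  enough and the larger of the two thresholds can be taken. The constant is 384 = 12 * 32: 12 from
  the rate bound, 32 from comparing the rate with the minimum in the theorem.\<close>

lemma activity_choice:
  fixes p d n \<epsilon> :: real
  assumes p: "2 \<le> p" and d: "1 \<le> d" and n: "1 \<le> n" and \<epsilon>: "0 < \<epsilon>"
  obtains \<rho> where "0 < \<rho>" "\<rho> \<le> 1" "2 * n * \<epsilon> * min (sqrt (d * \<rho>)) (2 * (d * \<rho>)) \<le> d / 4"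
    "1 / 384 * Min {(d / (\<epsilon>\<^sup>2 * n\<^sup>2)) powr (1 / p), d powr (1 - 1 / p) / (\<epsilon> * n), 1}
      \<le> d powr (- (1 / p)) * (\<rho> * (1 + d * \<rho>) powr (- (1 - 1 / p))) * d / 12"
proof -
  define g where "g = 1 - 1 / p"
  have g: "0 \<le> g" "g \<le> 1" "1 / p \<le> 1 / 2" "0 \<le> 1 / p" unfolding g_def using p by (auto simp: field_simps)
  \<comment> \<open>At \<open>\<rho> = a\<close> the square root branch of the privacy condition is
    an equality, and at \<open>\<rho> = c\<close> the linear branch is.\<close>
  define a where "a = d / (64 * (\<epsilon> * n)\<^sup>2)"
  define c where "c = 1 / (16 * (\<epsilon> * n))"
  define \<rho> where "\<rho> = min 1 (max a c)"
  define X where "X = d powr g * (\<rho> * (1 + d * \<rho>) powr (- g))"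
  have en: "0 < \<epsilon> * n" using \<epsilon> n by auto
  have ac: "0 < a" "0 < c"
    unfolding a_def c_def using en d by (auto intro!: divide_pos_pos mult_pos_pos zero_less_power)
  have \<rho>: "0 < \<rho>" "\<rho> \<le> 1" unfolding \<rho>_def using ac by auto
  have 1: "2 * n * \<epsilon> * min (sqrt (d * \<rho>)) (2 * (d * \<rho>)) \<le> d / 4"
  proof (cases "\<rho> \<le> a")
    case True
    have "d * \<rho> \<le> d * a" using True d by simp
    also have "\<dots> = (d / (8 * (\<epsilon> * n)))\<^sup>2" unfolding a_def by (simp add: power2_eq_square)
    finally have "sqrt (d * \<rho>) \<le> d / (8 * (\<epsilon> * n))"
      using en d by (intro real_le_lsqrt) auto
    then have "2 * n * \<epsilon> * min (sqrt (d * \<rho>)) (2 * (d * \<rho>)) \<le> 2 * n * \<epsilon> * (d / (8 * (\<epsilon> * n)))"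
      using n \<epsilon> by (intro mult_left_mono) auto
    also have "\<dots> = d / 4" using n \<epsilon> by simp
    finally show ?thesis .
  next
    case False
    then have "\<rho> \<le> c" unfolding \<rho>_def by auto
    then have "2 * (d * \<rho>) \<le> 2 * (d * c)" using d by simp
    then have "2 * n * \<epsilon> * min (sqrt (d * \<rho>)) (2 * (d * \<rho>)) \<le> 2 * n * \<epsilon> * (2 * (d * c))"
      using n \<epsilon> by (intro mult_left_mono) auto
    also have "\<dots> = d / 4" unfolding c_def using n \<epsilon> by simp
    finally show ?thesis .
  qed
  have half: "1 / 2 \<le> 2 powr (- g)"
    using powr_mono[of "-1" "- g" "2::real"] g by (simp add: powr_neg_one)
  have "Min {(d / (\<epsilon>\<^sup>2 * n\<^sup>2)) powr (1 / p), d powr g / (\<epsilon> * n), 1} \<le> 32 * X"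
  \<comment> \<open>For \<open>d * \<rho> \<ge> 1\<close> a typical support is large and
    \<open>X\<close> is at least \<open>\<rho> powr (1 / p) / 2\<close>, which leads to the first
    and third terms of the minimum. Otherwise \<open>X\<close> is at least
    \<open>d powr g * \<rho> / 2\<close>, which leads to the second.\<close>
  proof (cases "1 \<le> d * \<rho>")
    case True
    have "1 / 2 * (d * \<rho>) powr (- g) \<le> 2 powr (- g) * (d * \<rho>) powr (- g)"
      using half by (intro mult_right_mono) auto
    also have "\<dots> = (2 * (d * \<rho>)) powr (- g)" using d \<rho> by (simp add: powr_mult)
    also have "\<dots> \<le> (1 + d * \<rho>) powr (- g)"
      using True g by (intro powr_mono2') (auto simp: mult.commute)
    finally have "d powr g * (\<rho> * (1 / 2 * (d * \<rho>) powr (- g))) \<le> X"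
      unfolding X_def using \<rho> by (intro mult_left_mono) auto
    moreover have "d powr g * (\<rho> * (1 / 2 * (d * \<rho>) powr (- g))) = 1 / 2 * (\<rho> * \<rho> powr (- g))"
      using d \<rho> by (simp add: powr_mult powr_minus field_simps)
    moreover have "\<rho> * \<rho> powr (- g) = \<rho> powr (1 / p)"
      using \<rho> powr_add[of \<rho> 1 "- g"] by (simp add: g_def)
    ultimately have X: "\<rho> powr (1 / p) / 2 \<le> X" by simp
    show ?thesis
    proof (cases "\<rho> = 1")
      case True
      have "Min {(d / (\<epsilon>\<^sup>2 * n\<^sup>2)) powr (1 / p), d powr g / (\<epsilon> * n), 1} \<le> 1" by (intro Min_le) auto
      then show ?thesis using X True by simp
    next
      case False
      then have "a \<le> \<rho>" unfolding \<rho>_def by (auto simp: min_def split: if_splits)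
      then have "a powr (1 / p) \<le> \<rho> powr (1 / p)" using ac g by (intro powr_mono2) auto
      moreover have "a powr (1 / p) = (1 / 64) powr (1 / p) * (d / (\<epsilon>\<^sup>2 * n\<^sup>2)) powr (1 / p)"
        unfolding a_def using d by (simp add: power_mult_distrib flip: powr_mult)
      \<comment> \<open>The assumption \<open>p \<ge> 2\<close> keeps this constant independent of
        \<open>p\<close>.\<close>
      moreover have "1 / 8 \<le> (1 / 64 :: real) powr (1 / p)"
      proof -
        have "(1 / 64 :: real) powr (1 / 2) \<le> (1 / 64) powr (1 / p)"
          using g by (intro powr_mono') auto
        moreover have "(1 / 64 :: real) powr (1 / 2) = 1 / 8"
          by (simp add: powr_half_sqrt real_sqrt_divide)
        ultimately show ?thesis by simp
      qed
      then have "1 / 8 * (d / (\<epsilon>\<^sup>2 * n\<^sup>2)) powr (1 / p) \<le> (1 / 64) powr (1 / p) * (d / (\<epsilon>\<^sup>2 * n\<^sup>2)) powr (1 / p)"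
        by (intro mult_right_mono) auto
      ultimately have "(d / (\<epsilon>\<^sup>2 * n\<^sup>2)) powr (1 / p) \<le> 16 * X" using X by linarith
      moreover have "0 \<le> X" using X powr_ge_zero[of \<rho> "1 / p"] by linarith
      moreover have "Min {(d / (\<epsilon>\<^sup>2 * n\<^sup>2)) powr (1 / p), d powr g / (\<epsilon> * n), 1} \<le> (d / (\<epsilon>\<^sup>2 * n\<^sup>2)) powr (1 / p)"
        by (intro Min_le) auto
      ultimately show ?thesis by linarith
    qed
  next
    case False
    have "1 / 2 \<le> 2 powr (- g)" by (rule half)
    also have "\<dots> \<le> (1 + d * \<rho>) powr (- g)"
      using False g d \<rho> by (intro powr_mono2') (auto intro: add_pos_nonneg)
    finally have "d powr g * (\<rho> * (1 / 2)) \<le> X"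
      unfolding X_def using \<rho> by (intro mult_left_mono) auto
    \<comment> \<open>As \<open>d \<ge> 1\<close>, a small \<open>d * \<rho>\<close> excludes the
      cap at 1, so \<open>\<rho>\<close> is the maximum of \<open>a\<close> and
      \<open>c\<close>.\<close>
    moreover have "\<rho> < 1" using False d \<rho> mult_right_mono[of 1 d \<rho>] by linarith
    then have "c \<le> \<rho>" unfolding \<rho>_def by (auto simp: min_def split: if_splits)
    then have "d powr g * (c * (1 / 2)) \<le> d powr g * (\<rho> * (1 / 2))" by (intro mult_left_mono) auto
    moreover have "d powr g * (c * (1 / 2)) = d powr g / (\<epsilon> * n) / 32" unfolding c_def by simp
    ultimately have "d powr g / (\<epsilon> * n) / 32 \<le> X" by (metis order_trans)
    then have "d powr g / (\<epsilon> * n) \<le> 32 * X" by (subst (asm) divide_le_eq_numeral1) (simp add: mult.commute)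
    moreover have "Min {(d / (\<epsilon>\<^sup>2 * n\<^sup>2)) powr (1 / p), d powr g / (\<epsilon> * n), 1} \<le> d powr g / (\<epsilon> * n)"
      by (intro Min_le) auto
    ultimately show ?thesis by (rule order_trans[rotated])
  qed
  moreover have "d powr (- (1 / p)) * (\<rho> * (1 + d * \<rho>) powr (- g)) * d = X"
  proof -
    have "d powr (- (1 / p)) * d = d powr g"
      using d powr_add[of d "- (1 / p)" 1] by (simp add: g_def)
    then show ?thesis unfolding X_def by (metis mult.assoc mult.commute)
  qed
  ultimately show ?thesis
    using that[OF \<rho> 1] unfolding g_def by simp
qed

theorem theorem2p8:
  "\<exists>c::real. c > 0 \<and>
    (\<forall>(p::real) (d::nat) (n::nat). p \<ge> 2 \<longrightarrow> d \<ge> 1 \<longrightarrow> n \<ge> 1 \<longrightarrow>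
      (\<exists>(\<Theta>::(nat \<Rightarrow> real) set) (Z::(nat \<Rightarrow> real) measure) (f::(nat \<Rightarrow> real) \<Rightarrow> (nat \<Rightarrow> real) \<Rightarrow> real).
        lp_sco_problem p d \<Theta> Z f \<and>
        (\<forall>(\<epsilon>::real) (\<delta>::real).
          0 < \<epsilon> \<longrightarrow> \<epsilon> \<le> 1 \<longrightarrow> 0 \<le> \<delta> \<longrightarrow> \<delta> < 1 \<longrightarrow> \<delta> \<le> c / real n \<longrightarrow>
          (\<forall>A (\<alpha>::real). learning_algorithm d n \<Theta> Z A \<longrightarrow> diff_private \<epsilon> \<delta> d n \<Theta> Z A \<longrightarrow>
            \<alpha> > 0 \<longrightarrow> is_learner \<alpha> n \<Theta> Z f A \<longrightarrow>
            \<alpha> \<ge> c * Min {(real d / (\<epsilon>\<^sup>2 * (real n)\<^sup>2)) powr (1 / p),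
                         real d powr (1 - 1 / p) / (\<epsilon> * real n),
                         1}))))"
\<comment> \<open>One constant serves twice: as the factor in the rate and as the bound on
  \<open>n * \<delta>\<close>, for which 1/16 would suffice.\<close>
proof (intro exI[of _ "1 / 384"] conjI allI impI)
  fix p :: real and d n :: nat
  assume p: "2 \<le> p" and d: "1 \<le> d" and n: "1 \<le> n"
  define r where "r = real d powr (- (1 / p))"
  have r: "0 < r" unfolding r_def using d by simp
  show "\<exists>(\<Theta>::(nat \<Rightarrow> real) set) (Z::(nat \<Rightarrow> real) measure) (f::(nat \<Rightarrow> real) \<Rightarrow> (nat \<Rightarrow> real) \<Rightarrow> real).
        lp_sco_problem p d \<Theta> Z f \<and>
        (\<forall>(\<epsilon>::real) (\<delta>::real).
          0 < \<epsilon> \<longrightarrow> \<epsilon> \<le> 1 \<longrightarrow> 0 \<le> \<delta> \<longrightarrow> \<delta> < 1 \<longrightarrow> \<delta> \<le> 1 / 384 / real n \<longrightarrow>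
          (\<forall>A (\<alpha>::real). learning_algorithm d n \<Theta> Z A \<longrightarrow> diff_private \<epsilon> \<delta> d n \<Theta> Z A \<longrightarrow>
            \<alpha> > 0 \<longrightarrow> is_learner \<alpha> n \<Theta> Z f A \<longrightarrow>
            \<alpha> \<ge> 1 / 384 * Min {(real d / (\<epsilon>\<^sup>2 * (real n)\<^sup>2)) powr (1 / p),
                         real d powr (1 - 1 / p) / (\<epsilon> * real n),
                         1}))"
  proof (intro exI conjI allI impI)
    show "lp_sco_problem p d (cube r d) (count_space (ternary d)) (loss (1 - 1 / p) d)"
      unfolding r_def using p d by (intro lp_sco_problem_loss) auto
    fix \<epsilon> \<delta> \<alpha> :: real and A :: "(nat \<Rightarrow> nat \<Rightarrow> real) \<Rightarrow> (nat \<Rightarrow> real) measure"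
    assume \<epsilon>: "0 < \<epsilon>" "\<epsilon> \<le> 1" and \<delta>: "0 \<le> \<delta>" "\<delta> \<le> 1 / 384 / real n"
      and A: "learning_algorithm d n (cube r d) (count_space (ternary d)) A"
      and DP: "diff_private \<epsilon> \<delta> d n (cube r d) (count_space (ternary d)) A"
      and L: "is_learner \<alpha> n (cube r d) (count_space (ternary d)) (loss (1 - 1 / p) d) A"
    obtain \<rho> where \<rho>: "0 < \<rho>" "\<rho> \<le> 1" "2 * real n * \<epsilon> * min (sqrt (real d * \<rho>)) (2 * (real d * \<rho>)) \<le> real d / 4"
      and rate: "1 / 384 * Min {(real d / (\<epsilon>\<^sup>2 * (real n)\<^sup>2)) powr (1 / p), real d powr (1 - 1 / p) / (\<epsilon> * real n), 1}
        \<le> r * (\<rho> * (1 + real d * \<rho>) powr (- (1 - 1 / p))) * real d / 12"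
      using activity_choice[of p "real d" "real n" \<epsilon>] p d n \<epsilon> unfolding r_def by auto
    have "real n * \<delta> \<le> 1 / 384" using \<delta> n by (simp add: field_simps)
    then have "real n * \<delta> \<le> 1 / 16" by simp
    moreover have "0 \<le> 1 - 1 / p" using p by simp
    ultimately have "r * (\<rho> * (1 + real d * \<rho>) powr (- (1 - 1 / p))) * real d / 12 \<le> \<alpha>"
      using \<epsilon> by (intro learner_rate_bound[OF \<rho>(1,2) r _ A DP L _ \<epsilon>(2) \<delta>(1) \<rho>(3)]) auto
    then show "1 / 384 * Min {(real d / (\<epsilon>\<^sup>2 * (real n)\<^sup>2)) powr (1 / p), real d powr (1 - 1 / p) / (\<epsilon> * real n), 1} \<le> \<alpha>"
      using rate by linarith
  qed
qed simp

end
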